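(* (i) For every $g\in H_2\cap W(\mathbb{R})$, $$Z_{\sqrt2}\,g(x,\gamma)=0\quad\text{for all }(x,\gamma)\in\bigl(\tfrac14\mathbb{Z}\setminus\mathbb{Z}\bigr)\times\bigl(\mathbb{Z}+\tfrac12\bigr),$$ and $$Z_{\sqrt3}\,g(x,\gamma)=0\quad\text{for all }(x,\gamma)\in\bigl(\tfrac13\mathbb{Z}+\tfrac16\bigr)\times\bigl(\mathbb{Z}+\tfrac12\bigr).$$ (ii) For every $g\in H_3\cap W(\mathbb{R})$ and every $s\in\{2,3,4\}$, $$Z_{\sqrt s}\,g(x,\gamma)=0\quad\text{for all }(x,\gamma)\in\tfrac1s\mathbb{Z}\times\mathbb{Z}.$$
   Context: The Fourier transform is $\mathcal{F}f(\gamma)=\int_{\mathbb{R}}f(x)e^{-2\pi i\gamma x}\,dx$ for $f\in L^1(\mathbb{R})$, extended as usual to $L^2(\mathbb{R})$. For $j\in\{0,1,2,3\}$, $H_j=\ker(\mathcal{F}-(-i)^jI)\subset L^2(\mathbb{R})$ is the eigenspace of the Fourier transform for the eigenvalue $(-i)^j$; thus $H_2$ corresponds to the eigenvalue $-1$ and $H_3$ to the eigenvalue $i$. The Wiener space $W(\mathbb{R})$ consists of the functions $g\in L^\infty(\mathbb{R})$ with $\sum_{k\in\mathbb{Z}}\operatorname{ess\,sup}_{x\in[0,1]}|g(x+k)|<\infty$. A function in $H_j\cap W(\mathbb{R})$ is continuous (after identification with its continuous representative, since its Fourier transform is in $L^1(\mathbb{R})$). For $\lambda>0$ the Zak transform is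 $Z_\lambda f(x,\gamma)=\sqrt\lambda\sum_{k\in\mathbb{Z}}f(\lambda(x+k))e^{-2\pi ik\gamma}$, $x,\gamma\in\mathbb{R}$. For continuous $f\in W(\mathbb{R})$ the series converges absolutely for every $(x,\gamma)$, and values of $Z_\lambda f$ are understood pointwise. *)

theory Defs
  imports "HOL-Probability.Essential_Supremum"
begin

text \<open>
  Elements of the Lebesgue spaces are represented by Borel measurable functions, which are
  identified when they agree almost everywhere; every Lebesgue measurable function has a Borel
  representative.
\<close>

definition L1_space :: "(real \<Rightarrow> complex) set" where
  "L1_space = {f. integrable lborel f}"

definition L2_space :: "(real \<Rightarrow> complex) set" where
  "L2_space = {f \<in> borel_measurable lborel. integrable lborel (\<lambda>x. (cmod (f x))\<^sup>2)}"

definition fourier :: "(real \<Rightarrow> complex) \<Rightarrow> real \<Rightarrow> complex" where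
  "fourier f \<gamma> = (\<integral>x. f x * exp (- 2 * of_real pi * \<i> * of_real \<gamma> * of_real x) \<partial>lborel)"

text \<open>
  The squared $L^2$ distance is taken in the extended nonnegative reals, so that it is infinite
  rather than a default value when the difference is not square integrable.
\<close>

definition L2_dist_sq :: "(real \<Rightarrow> complex) \<Rightarrow> (real \<Rightarrow> complex) \<Rightarrow> ennreal" where
  "L2_dist_sq f g = (\<integral>\<^sup>+x. ennreal ((cmod (f x - g x))\<^sup>2) \<partial>lborel)"

text \<open>
  The Fourier transform on $L^2$ is the continuous extension of the Fourier transform on
  $L^1 \cap L^2$, that is, the closure of its graph. As $L^2$ functions are only determined
  almost everywhere, it is a relation here: \<open>h\<close> is a representative of the transform of \<open>f\<close>.
\<close>

definition is_fourier_L2 :: "(real \<Rightarrow> complex) \<Rightarrow> (real \<Rightarrow> complex) \<Rightarrow> bool" where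
  "is_fourier_L2 f h \<longleftrightarrow> f \<in> L2_space \<and> h \<in> L2_space \<and>
     (\<exists>F :: nat \<Rightarrow> real \<Rightarrow> complex.
        (\<forall>n. F n \<in> L1_space \<inter> L2_space) \<and>
        (\<lambda>n. L2_dist_sq (F n) f) \<longlonglongrightarrow> 0 \<and>
        (\<lambda>n. L2_dist_sq (fourier (F n)) h) \<longlonglongrightarrow> 0)"

definition fourier_eigenspace :: "nat \<Rightarrow> (real \<Rightarrow> complex) set" where
  "fourier_eigenspace j = {f \<in> L2_space. is_fourier_L2 f (\<lambda>x. (- \<i>) ^ j * f x)}"

definition local_esssup :: "(real \<Rightarrow> complex) \<Rightarrow> int \<Rightarrow> ennreal" where
  "local_esssup g k =
     esssup (restrict_space lborel {0..1}) (\<lambda>x. ennreal (cmod (g (x + of_int k))))"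

definition wiener_space :: "(real \<Rightarrow> complex) set" where
  "wiener_space = {g \<in> borel_measurable lborel.
     esssup lborel (\<lambda>x. ennreal (cmod (g x))) < \<infinity> \<and>
     (\<Sum>\<^sub>\<infinity>k\<in>UNIV. local_esssup g k) < \<infinity>}"

text \<open>
  Pointwise values of a function that is only given up to null sets are those of its
  continuous representative; if there is none, nothing is specified.
\<close>

definition continuous_rep :: "(real \<Rightarrow> complex) \<Rightarrow> real \<Rightarrow> complex" where
  "continuous_rep g = (THE h. continuous_on UNIV h \<and> (AE x in lborel. h x = g x))"

definition zak :: "real \<Rightarrow> (real \<Rightarrow> complex) \<Rightarrow> real \<Rightarrow> real \<Rightarrow> complex" where
  "zak \<alpha> f x \<gamma> = of_real (sqrt \<alpha>) *
     (\<Sum>\<^sub>\<infinity>k\<in>(UNIV :: int set).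
        f (\<alpha> * (x + of_int k)) * exp (- 2 * of_real pi * \<i> * of_int k * of_real \<gamma>))"

lemma open_null_imp_empty:
  fixes A :: "real set"
  assumes "open A" "A \<in> null_sets lborel"
  shows "A = {}"
proof (rule ccontr)
  assume "A \<noteq> {}"
  then have "\<not> negligible A" using open_not_negligible assms(1) by blast
  moreover have "A \<in> null_sets lebesgue"
    using assms(2) by (rule null_sets_completionI)
  ultimately show False by (simp add: negligible_iff_null_sets)
qed

lemma continuous_AE_eq_imp_eq:
  fixes f g :: "real \<Rightarrow> complex"
  assumes "continuous_on UNIV f" "continuous_on UNIV g" "AE x in lborel. f x = g x"
  shows "f = g"
proof -
  have o: "open {x. f x \<noteq> g x}"
    using assms(1,2) by (rule open_Collect_neq)
  have "{x. f x \<noteq> g x} \<in> null_sets lborel"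
    using assms(3) o by (subst AE_iff_null_sets) auto
  with o have "{x. f x \<noteq> g x} = {}" by (rule open_null_imp_empty)
  then show ?thesis by auto
qed

lemma continuous_rep_eqI:
  assumes "continuous_on UNIV h" "AE x in lborel. h x = g x"
  shows "continuous_rep g = h"
  unfolding continuous_rep_def
proof (rule the_equality)
  show "continuous_on UNIV h \<and> (AE x in lborel. h x = g x)" using assms by simp
next
  fix h' assume h': "continuous_on UNIV h' \<and> (AE x in lborel. h' x = g x)"
  then have "AE x in lborel. h' x = g x" by simp
  with assms(2) have "AE x in lborel. h' x = h x"
    by eventually_elim simp
  with h' assms(1) show "h' = h" by (intro continuous_AE_eq_imp_eq) auto
qed

lemma cmod_le_local_esssup:
  fixes g :: "real \<Rightarrow> complex"
  assumes cont: "continuous_on UNIV g" and fin: "local_esssup g k < \<infinity>"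
  assumes "x \<in> {0..1}"
  shows "cmod (g (x + of_int k)) \<le> enn2real (local_esssup g k)"
proof -
  define c where "c = enn2real (local_esssup g k)"
  define u where "u = (\<lambda>x. cmod (g (x + of_int k)))"
  have cu: "continuous_on UNIV u"
    unfolding u_def by (intro continuous_intros continuous_on_compose2[OF cont]) auto
  have "AE x in restrict_space lborel {0..1}. ennreal (u x) \<le> local_esssup g k"
    unfolding local_esssup_def u_def by (rule esssup_AE)
  moreover have "local_esssup g k = ennreal c"
    using fin by (simp add: c_def)
  ultimately have "AE x in restrict_space lborel {0..1}. ennreal (u x) \<le> ennreal c"
    by (simp only:)
  moreover have "0 \<le> c" by (simp add: c_def)
  ultimately have "AE x in restrict_space lborel {0..1}. u x \<le> c"
    by (simp only: ennreal_le_iff)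
  then have ae: "AE x in lborel. x \<in> {0..1} \<longrightarrow> u x \<le> c"
    by (simp add: AE_restrict_space_iff)
  have o: "open ({0<..<1} \<inter> {x. c < u x})"
    by (rule open_Int[OF open_greaterThanLessThan open_Collect_less[OF continuous_on_const cu]])
  have "AE x in lborel. x \<notin> {0<..<1} \<inter> {x. c < u x}"
    using ae by eventually_elim auto
  then have "{0<..<1} \<inter> {x. c < u x} \<in> null_sets lborel"
    using o by (subst AE_iff_null_sets) auto
  with o have "{0<..<1} \<inter> {x. c < u x} = {}" by (rule open_null_imp_empty)
  then have "{0<..<1} \<subseteq> {x. u x \<le> c}" by fastforce
  moreover have "closed {x. u x \<le> c}"
    by (rule closed_Collect_le[OF cu continuous_on_const])
  ultimately have "closure {0<..<1} \<subseteq> {x. u x \<le> c}" by (rule closure_minimal)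
  then have "{0..1} \<subseteq> {x. u x \<le> c}" by simp
  with assms(3) have "u x \<le> c" by (auto dest: subsetD)
  then show ?thesis by (simp only: u_def c_def)
qed

text \<open>
  The series in the definition of \<open>zak\<close> converges absolutely for continuous functions in the
  Wiener space, so the default value of a divergent sum never occurs there.
\<close>

lemma zak_abs_summable:
  fixes g :: "real \<Rightarrow> complex"
  assumes cont: "continuous_on UNIV g" and W: "g \<in> wiener_space" and lam: "\<alpha> > 0"
  shows "(\<lambda>k::int. cmod (g (\<alpha> * (x + of_int k)) *
           exp (- 2 * of_real pi * \<i> * of_int k * of_real \<gamma>))) summable_on UNIV"
proof -
  define S where "S = (\<Sum>\<^sub>\<infinity>k\<in>UNIV. local_esssup g k)"
  define a where "a k = enn2real (local_esssup g k)" for k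
  have S: "S < \<infinity>" using W by (simp add: wiener_space_def S_def)
  have sum_le: "(\<Sum>k\<in>F. local_esssup g k) \<le> S" if "finite F" for F
  proof -
    have "(\<Sum>k\<in>F. local_esssup g k) = (\<Sum>\<^sub>\<infinity>k\<in>F. local_esssup g k)" using that by simp
    also have "\<dots> \<le> S" unfolding S_def
      by (rule infsum_mono_neutral) (auto intro: nonneg_summable_on_complete)
    finally show ?thesis .
  qed
  have fin: "local_esssup g k < \<infinity>" for k
    using sum_le[of "{k}"] S by (auto simp: less_top[symmetric] top_unique)
  have suma: "(\<Sum>k\<in>F. a k) \<le> enn2real S" if "finite F" for F
  proof -
    have "ennreal (\<Sum>k\<in>F. a k) = (\<Sum>k\<in>F. local_esssup g k)"
      using fin by (subst sum_ennreal[symmetric]) (auto simp: a_def)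
    also have "\<dots> \<le> S" using that by (rule sum_le)
    also have "S = ennreal (enn2real S)" using S by simp
    finally show ?thesis by (simp add: ennreal_le_iff)
  qed
  have ga: "cmod (g y) \<le> a \<lfloor>y\<rfloor>" for y
    using cmod_le_local_esssup[OF cont fin, of "y - of_int \<lfloor>y\<rfloor>" "\<lfloor>y\<rfloor>"]
    unfolding a_def by (simp; linarith)
  define \<phi> where "\<phi> k = \<lfloor>\<alpha> * (x + of_int k)\<rfloor>" for k :: int
  define M where "M = \<lceil>1 / \<alpha>\<rceil>"
  have fibre: "real (card {k \<in> F. \<phi> k = m}) \<le> real (nat (2 * M + 1))"
    if "finite F" for F m
  proof (cases "{k \<in> F. \<phi> k = m} = {}")
    case False
    then obtain l where l: "\<phi> l = m" by auto
    have "{k \<in> F. \<phi> k = m} \<subseteq> {l - M..l + M}"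
    proof
      fix k assume "k \<in> {k \<in> F. \<phi> k = m}"
      then have "\<phi> k = \<phi> l" using l by simp
      then have "\<bar>\<alpha> * (x + of_int k) - \<alpha> * (x + of_int l)\<bar> < 1"
        unfolding \<phi>_def by linarith
      moreover have "\<alpha> * (x + of_int k) - \<alpha> * (x + of_int l) = \<alpha> * of_int (k - l)"
        by (simp add: algebra_simps)
      ultimately have "\<alpha> * \<bar>of_int (k - l)\<bar> < 1" using lam by (simp add: abs_mult)
      then have "\<bar>of_int (k - l)\<bar> < 1 / \<alpha>" using lam by (simp add: field_simps)
      also have "1 / \<alpha> \<le> of_int M" unfolding M_def by (rule le_of_int_ceiling)
      finally have "\<bar>k - l\<bar> < M" by linarith
      then show "k \<in> {l - M..l + M}" by auto
    qed
    then have "card {k \<in> F. \<phi> k = m} \<le> card {l - M..l + M}" by (intro card_mono) auto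
    then show ?thesis by (simp add: algebra_simps)
  qed (simp only: card.empty of_nat_0 of_nat_0_le_iff)
  have bound: "(\<Sum>k\<in>F. cmod (g (\<alpha> * (x + of_int k)))) \<le> real (nat (2 * M + 1)) * enn2real S"
    if F: "finite F" for F
  proof -
    have "(\<Sum>k\<in>F. cmod (g (\<alpha> * (x + of_int k)))) \<le> (\<Sum>k\<in>F. a (\<phi> k))"
      unfolding \<phi>_def by (intro sum_mono ga)
    also have "\<dots> = (\<Sum>m\<in>\<phi> ` F. \<Sum>k\<in>{k \<in> F. \<phi> k = m}. a (\<phi> k))"
      using F by (rule sum.image_gen)
    also have "\<dots> = (\<Sum>m\<in>\<phi> ` F. real (card {k \<in> F. \<phi> k = m}) * a m)"
      by (intro sum.cong) auto
    also have "\<dots> \<le> (\<Sum>m\<in>\<phi> ` F. real (nat (2 * M + 1)) * a m)"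
      using fibre[OF F] by (intro sum_mono mult_right_mono) (auto simp: a_def)
    also have "\<dots> = real (nat (2 * M + 1)) * (\<Sum>m\<in>\<phi> ` F. a m)"
      by (simp add: sum_distrib_left)
    also have "\<dots> \<le> real (nat (2 * M + 1)) * enn2real S"
      using F by (intro mult_left_mono suma) auto
    finally show ?thesis .
  qed
  have "cmod (exp (- 2 * of_real pi * \<i> * of_int k * of_real \<gamma>)) = 1" for k :: int
    by simp
  then have "cmod (g (\<alpha> * (x + of_int k)) * exp (- 2 * of_real pi * \<i> * of_int k * of_real \<gamma>))
      = cmod (g (\<alpha> * (x + of_int k)))" for k :: int
    unfolding norm_mult by simp
  then have *: "(\<Sum>k\<in>F. cmod (g (\<alpha> * (x + of_int k)) *
      exp (- 2 * of_real pi * \<i> * of_int k * of_real \<gamma>))) \<le> real (nat (2 * M + 1)) * enn2real S"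
    if "finite F" for F :: "int set"
    using bound[OF that] by (simp only:)
  show ?thesis
  proof (rule nonneg_bdd_above_summable_on[OF norm_ge_zero], rule bdd_aboveI)
    fix y assume "y \<in> sum (\<lambda>k. cmod (g (\<alpha> * (x + of_int k)) *
      exp (- 2 * of_real pi * \<i> * of_int k * of_real \<gamma>))) ` {F. F \<subseteq> UNIV \<and> finite F}"
    then show "y \<le> real (nat (2 * M + 1)) * enn2real S" using * by blast
  qed
qed

end

theory Submission
  imports Defs "HOL-Probability.Sinc_Integral"
begin

text \<open>
  The points in question are singled out by the symmetries of the Zak transform. Poisson summation
  turns the Fourier transform into a rotation of the Zak domain: if \<open>fourier f = c f\<close> holds pointwise,
  then \<open>zak \<alpha> f x \<gamma>\<close> equals \<open>c * cis (2 \<pi> x \<gamma>) * zak (1 / \<alpha>) f \<gamma> (- x)\<close>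
  (\<open>zak_fourier_eigenfunction\<close>). Two consequences are used. Rotating twice gives
  \<open>zak \<alpha> f x \<gamma> = c\<^sup>2 * zak \<alpha> f (- x) (- \<gamma>)\<close> (\<open>zak_eigenfunction_reflect\<close>), so that \<open>zak \<alpha> f\<close> is even for the
  eigenvalue \<open>- 1\<close> and odd for the eigenvalue \<open>\<i>\<close>. For \<open>\<alpha> = sqrt s\<close> with an integer \<open>s\<close>, sorting the series
  with spacing \<open>1 / \<alpha>\<close> by residue classes modulo \<open>s\<close> expresses \<open>zak \<alpha> f x \<gamma>\<close> as a combination of the \<open>s\<close> values
  of the same function at \<open>((\<gamma> + r) / s, - s x)\<close> (\<open>zak_sqrt_eigenfunction\<close>).

  Up to integer translations, under which the Zak transform changes by a phase, there are only
  finitely many points to consider. Some are fixed by the point reflection and translations, but with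
  the opposite sign of the value. At the others, parity and these zeros reduce the combination to a multiple of the
  value itself, and the multiple turns out to be \<open>c\<close> for the eigenvalue \<open>c = - 1\<close> and \<open>\<i> c\<close> for \<open>c = \<i>\<close>. It is \<open>- 1\<close> in both
  cases, so the value is zero.

  Before this, two analytic points have to be settled. The eigenspaces are defined through the
  extension of the Fourier transform to \<open>L\<^sup>2\<close>; for integrable functions this extension agrees
  almost everywhere with the integral (\<open>is_fourier_L2_eq_fourier\<close>), and hence the continuous
  representative of an eigenfunction is an eigenfunction of the integral transform at every point
  (\<open>continuous_rep_eigenfunction\<close>). Poisson summation itself is proved by comparing Fourier
  coefficients, which determine a continuous function on a period
  (\<open>zero_if_fourier_coefficients_zero\<close>).
\<close>

section \<open>The integral Fourier transform and its square integrable extension\<close>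

lemma fourier_cis: "fourier f t = (\<integral>x. f x * cis (- (2 * pi * t * x)) \<partial>lborel)"
  unfolding fourier_def by (simp add: cis_conv_exp mult_ac)

lemma fourier_integrand_integrable:
  assumes "integrable lborel f"
  shows "integrable lborel (\<lambda>x. f x * cis (- (2 * pi * t * x)))"
proof (rule Bochner_Integration.integrable_bound[OF assms])
  have [measurable]: "f \<in> borel_measurable borel" using assms by simp
  have [measurable]: "(\<lambda>x. cis (- (2 * pi * t * x))) \<in> borel_measurable borel"
    by (intro borel_measurable_continuous_onI continuous_intros)
  show "(\<lambda>x. f x * cis (- (2 * pi * t * x))) \<in> borel_measurable lborel" by simp
qed (simp add: norm_mult)

lemma norm_fourier_le:
  assumes "integrable lborel f"
  shows "cmod (fourier f t) \<le> (\<integral>x. cmod (f x) \<partial>lborel)"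
  unfolding fourier_cis
  using integral_norm_bound[of lborel "\<lambda>x. f x * cis (- (2 * pi * t * x))"]
  by (simp add: norm_mult)

lemma continuous_fourier:
  assumes f: "integrable lborel f"
  shows "continuous_on UNIV (fourier f)"
proof (rule continuous_at_imp_continuous_on, rule ballI)
  fix t
  show "isCont (fourier f) t"
    unfolding continuous_at_sequentially
  proof safe
    fix X assume X: "X \<longlonglongrightarrow> t"
    show "(fourier f \<circ> X) \<longlonglongrightarrow> fourier f t"
      unfolding comp_def fourier_cis
    proof (rule integral_dominated_convergence[where w="\<lambda>x. cmod (f x)"])
      show "AE x in lborel. (\<lambda>i. f x * cis (- (2 * pi * X i * x)))
              \<longlonglongrightarrow> f x * cis (- (2 * pi * t * x))"
        by (auto intro!: tendsto_intros X)
    qed (use fourier_integrand_integrable[OF f] f in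
          \<open>auto simp: norm_mult intro: borel_measurable_integrable\<close>)
  qed
qed

lemma fourier_measurable:
  assumes "integrable lborel f"
  shows "fourier f \<in> borel_measurable borel"
  by (intro borel_measurable_continuous_onI continuous_fourier assms)

lemma fourier_cong_AE:
  assumes "AE x in lborel. f x = g x" "f \<in> borel_measurable borel" "g \<in> borel_measurable borel"
  shows "fourier f = fourier g"
proof
  fix t
  have [measurable]: "(\<lambda>x. cis (- (2 * pi * t * x))) \<in> borel_measurable borel"
    by (intro borel_measurable_continuous_onI continuous_intros)
  show "fourier f t = fourier g t"
    unfolding fourier_cis using assms by (intro integral_cong_AE) auto
qed

text \<open>
  Fubini's theorem moves the Fourier transform to the other factor. This is how the transform of
  an integrable function is tested against functions below, without Plancherel's theorem.
\<close>

lemma integral_fourier_mult_commute: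
  assumes f: "integrable lborel f" and g: "integrable lborel g"
  shows "(\<integral>t. fourier f t * g t \<partial>lborel) = (\<integral>x. f x * fourier g x \<partial>lborel)"
proof -
  have [measurable]: "f \<in> borel_measurable borel" "g \<in> borel_measurable borel"
    using f g by auto
  have [measurable]: "(\<lambda>p. cis (- (2 * pi * snd p * fst p)))
      \<in> borel_measurable (borel \<Otimes>\<^sub>M (borel :: real measure) :: (real \<times> real) measure)"
    unfolding borel_prod by (intro borel_measurable_continuous_onI continuous_intros)
  define k where "k = (\<lambda>(x::real) (t::real). f x * g t * cis (- (2 * pi * t * x)))"
  have meas: "case_prod k \<in> borel_measurable (lborel \<Otimes>\<^sub>M lborel)"
    unfolding k_def case_prod_beta by simp
  have int: "integrable (lborel \<Otimes>\<^sub>M lborel) (case_prod k)"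
  proof (rule lborel_pair.Fubini_integrable[OF meas])
    have "(\<integral>y. cmod (case_prod k (x, y)) \<partial>lborel) = cmod (f x) * (\<integral>y. cmod (g y) \<partial>lborel)" for x
      by (simp add: k_def norm_mult)
    then show "integrable lborel (\<lambda>x. \<integral>y. cmod (case_prod k (x, y)) \<partial>lborel)"
      using f by simp
    have "integrable lborel (\<lambda>y. f x * (g y * cis (- (2 * pi * x * y))))" for x
      by (intro integrable_mult_right fourier_integrand_integrable g)
    then show "AE x in lborel. integrable lborel (\<lambda>y. case_prod k (x, y))"
      by (simp add: k_def mult_ac)
  qed
  have "fourier f t * g t = (\<integral>x. k x t \<partial>lborel)" for t
    unfolding fourier_cis k_def
    by (subst integral_mult_left_zero[symmetric], intro Bochner_Integration.integral_cong)
       (simp_all add: mult_ac)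
  then have "(\<integral>t. fourier f t * g t \<partial>lborel) = (\<integral>t. (\<integral>x. k x t \<partial>lborel) \<partial>lborel)"
    by simp
  also have "\<dots> = (\<integral>x. (\<integral>t. k x t \<partial>lborel) \<partial>lborel)"
    by (rule lborel_pair.Fubini_integral[OF int])
  also have "(\<lambda>x. \<integral>t. k x t \<partial>lborel) = (\<lambda>x. f x * fourier g x)"
    unfolding fourier_cis k_def
    by (subst integral_mult_right_zero[symmetric], intro ext Bochner_Integration.integral_cong)
       (simp_all add: mult_ac)
  finally show ?thesis .
qed

lemma nn_integral_L2_pairing_le:
  fixes u v :: "real \<Rightarrow> complex"
  assumes [measurable]: "u \<in> borel_measurable borel" "v \<in> borel_measurable borel"
  shows "(\<integral>\<^sup>+x. ennreal (cmod (u x * v x)) \<partial>lborel)\<^sup>2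
    \<le> (\<integral>\<^sup>+x. ennreal ((cmod (u x))\<^sup>2) \<partial>lborel) * (\<integral>\<^sup>+x. ennreal ((cmod (v x))\<^sup>2) \<partial>lborel)"
  using Cauchy_Schwarz_nn_integral[of "\<lambda>x. ennreal (cmod (u x))" lborel "\<lambda>x. ennreal (cmod (v x))"]
  by (simp add: norm_mult ennreal_mult ennreal_power)

lemma L2_space_nn_integral:
  "f \<in> L2_space \<longleftrightarrow> f \<in> borel_measurable borel \<and> (\<integral>\<^sup>+x. ennreal ((cmod (f x))\<^sup>2) \<partial>lborel) < \<infinity>"
  unfolding L2_space_def by (auto simp: integrable_iff_bounded)

lemma L2_pairing_integrable:
  assumes "u \<in> L2_space" "v \<in> L2_space"
  shows "integrable lborel (\<lambda>x. u x * v x)"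
proof -
  have [measurable]: "u \<in> borel_measurable borel" "v \<in> borel_measurable borel"
    using assms by (auto simp: L2_space_nn_integral)
  have "(\<integral>\<^sup>+x. ennreal (cmod (u x * v x)) \<partial>lborel)\<^sup>2 < \<infinity>"
    using assms by (intro le_less_trans[OF nn_integral_L2_pairing_le])
      (auto simp: L2_space_nn_integral ennreal_mult_less_top)
  then have "(\<integral>\<^sup>+x. ennreal (cmod (u x * v x)) \<partial>lborel) < \<infinity>"
    by (auto simp: power2_eq_square ennreal_mult_less_top not_less)
  then show ?thesis by (simp add: integrable_iff_bounded)
qed

text \<open>
  By Cauchy--Schwarz, convergence in \<open>L\<^sup>2\<close> implies weak convergence.
\<close>

lemma L2_pairing_tendsto:
  assumes F: "\<And>n. integrable lborel (\<lambda>x. F n x * v x)" "\<And>n. F n \<in> borel_measurable borel"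
    and f: "f \<in> L2_space" and v: "v \<in> L2_space"
    and lim: "(\<lambda>n. L2_dist_sq (F n) f) \<longlonglongrightarrow> 0"
  shows "(\<lambda>n. \<integral>x. F n x * v x \<partial>lborel) \<longlonglongrightarrow> (\<integral>x. f x * v x \<partial>lborel)"
proof -
  have [measurable]: "f \<in> borel_measurable borel" "v \<in> borel_measurable borel"
      "F n \<in> borel_measurable borel" for n
    using f v F(2) by (auto simp: L2_space_nn_integral)
  define V where "V = (\<integral>\<^sup>+x. ennreal ((cmod (v x))\<^sup>2) \<partial>lborel)"
  have V: "V < \<infinity>" using v by (simp add: L2_space_nn_integral V_def)
  define d where "d n = (\<integral>x. F n x * v x \<partial>lborel) - (\<integral>x. f x * v x \<partial>lborel)" for n
  have fv: "integrable lborel (\<lambda>x. f x * v x)" by (rule L2_pairing_integrable[OF f v])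
  have le: "ennreal ((cmod (d n))\<^sup>2) \<le> V * L2_dist_sq (F n) f" for n
  proof -
    have i: "integrable lborel (\<lambda>x. (F n x - f x) * v x)"
      using Bochner_Integration.integrable_diff[OF F(1)[of n] fv] by (simp add: algebra_simps)
    have "d n = (\<integral>x. (F n x - f x) * v x \<partial>lborel)"
      unfolding d_def using F(1)[of n] fv
      by (simp add: algebra_simps flip: Bochner_Integration.integral_diff)
    then have "ennreal (cmod (d n)) \<le> (\<integral>\<^sup>+x. ennreal (cmod ((F n x - f x) * v x)) \<partial>lborel)"
      using integral_norm_bound_ennreal[OF i] by simp
    then have "(ennreal (cmod (d n)))\<^sup>2 \<le> (\<integral>\<^sup>+x. ennreal (cmod ((F n x - f x) * v x)) \<partial>lborel)\<^sup>2"
      by (intro power_mono) auto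
    also have "\<dots> \<le> L2_dist_sq (F n) f * V"
      unfolding L2_dist_sq_def V_def by (rule nn_integral_L2_pairing_le) auto
    finally show ?thesis by (simp add: ennreal_power mult.commute)
  qed
  have lim': "(\<lambda>n. V * L2_dist_sq (F n) f) \<longlonglongrightarrow> 0"
    using ennreal_tendsto_cmult[of V, OF _ lim] V by simp
  have "(\<lambda>n. ennreal ((cmod (d n))\<^sup>2)) \<longlonglongrightarrow> ennreal 0"
    unfolding ennreal_0
    by (rule tendsto_sandwich[OF _ _ tendsto_const lim']; rule always_eventually; intro allI zero_le le)
  then have "(\<lambda>n. (cmod (d n))\<^sup>2) \<longlonglongrightarrow> 0"
    by (simp only: tendsto_ennreal_iff eventually_True zero_le_power2 order_refl)
  then have "(\<lambda>n. sqrt ((cmod (d n))\<^sup>2)) \<longlonglongrightarrow> sqrt 0" by (rule tendsto_real_sqrt)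
  then have "(\<lambda>n. cmod (d n)) \<longlonglongrightarrow> 0" by simp
  then have "d \<longlonglongrightarrow> 0" by (rule tendsto_norm_zero_cancel)
  then show ?thesis unfolding d_def by (simp add: LIM_zero_iff)
qed

lemma integrable_indicator_complex:
  fixes a b :: real
  shows "integrable lborel (indicator {a..b} :: real \<Rightarrow> complex)"
proof -
  have "integrable lborel (\<lambda>x. complex_of_real (indicator {a..b} x))"
    by (intro integrable_of_real integrable_real_indicator) (auto simp: emeasure_lborel_Icc_eq)
  moreover have "(\<lambda>x. complex_of_real (indicator {a..b} x)) = indicator {a..b}"
    by (auto simp: indicator_def)
  ultimately show ?thesis by simp
qed

text \<open>
  The transform of an interval is bounded, and it decays like \<open>1 / t\<close> because the exponential has an
  explicit primitive; so its square is dominated by a multiple of \<open>1 / (1 + t\<^sup>2)\<close>.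
\<close>

lemma fourier_indicator_L2:
  assumes "a \<le> b"
  shows "fourier (indicator {a..b}) \<in> L2_space"
proof -
  define \<phi> :: "real \<Rightarrow> complex" where "\<phi> = indicator {a..b}"
  have \<phi>: "integrable lborel \<phi>" unfolding \<phi>_def by (rule integrable_indicator_complex)
  note [measurable] = fourier_measurable[OF \<phi>]
  define C where "C = b - a"
  have b1: "cmod (fourier \<phi> t) \<le> C" for t
  proof -
    have "cmod (fourier \<phi> t) \<le> (\<integral>x. cmod (\<phi> x) \<partial>lborel)" by (rule norm_fourier_le[OF \<phi>])
    also have "(\<lambda>x. cmod (\<phi> x)) = indicat_real {a..b}" by (auto simp: \<phi>_def indicator_def)
    finally show ?thesis using assms by (simp add: C_def)
  qed
  have b2: "cmod (fourier \<phi> t) * \<bar>t\<bar> \<le> 1" for t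
  proof (cases "t = 0")
    case False
    define G where "G = (\<lambda>x. \<i> / (2 * pi * t) * cis (- (2 * pi * t * x)))"
    have "fourier \<phi> t = (\<integral>x. indicator {a..b} x *\<^sub>R cis (- (2 * pi * t * x)) \<partial>lborel)"
      unfolding fourier_cis \<phi>_def by (intro Bochner_Integration.integral_cong) (auto simp: indicator_def)
    also have "\<dots> = G b - G a"
    proof (rule integral_FTC_atLeastAtMost[OF assms])
      fix x
      show "(G has_vector_derivative cis (- (2 * pi * t * x))) (at x within {a..b})"
        unfolding G_def using False
        by (auto intro!: derivative_eq_intros simp: has_vector_derivative_complex_iff)
    qed (intro continuous_intros)
    finally have "cmod (fourier \<phi> t) \<le> cmod (G b) + cmod (G a)" by (simp add: norm_triangle_ineq4)
    also have "\<dots> = 1 / (pi * \<bar>t\<bar>)" unfolding G_def by (simp add: norm_mult norm_divide)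
    finally have "cmod (fourier \<phi> t) * \<bar>t\<bar> \<le> 1 / pi" using False by (simp add: field_simps)
    also have "\<dots> \<le> 1" using pi_gt3 by (simp add: field_simps)
    finally show ?thesis .
  qed simp
  have bd: "(cmod (fourier \<phi> t))\<^sup>2 \<le> (C\<^sup>2 + 1) * inverse (1 + t\<^sup>2)" for t
  proof -
    have "(cmod (fourier \<phi> t))\<^sup>2 \<le> C\<^sup>2" using b1 by (intro power_mono) auto
    moreover have "(cmod (fourier \<phi> t) * \<bar>t\<bar>)\<^sup>2 \<le> 1\<^sup>2" by (rule power_mono[OF b2]) auto
    ultimately have "(cmod (fourier \<phi> t))\<^sup>2 * (1 + t\<^sup>2) \<le> C\<^sup>2 + 1"
      by (simp add: power_mult_distrib algebra_simps)
    then show ?thesis by (simp add: field_simps add_pos_nonneg)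
  qed
  have "integrable lborel (\<lambda>t::real. inverse (1 + t\<^sup>2))"
    using integrable_inverse_1_plus_square by (simp add: set_integrable_def)
  then have "integrable lborel (\<lambda>t::real. (C\<^sup>2 + 1) * inverse (1 + t\<^sup>2))" by simp
  then have "integrable lborel (\<lambda>t. (cmod (fourier \<phi> t))\<^sup>2)"
    by (rule Bochner_Integration.integrable_bound) (use bd in \<open>auto intro: order_trans[OF _ abs_ge_self]\<close>)
  then show ?thesis unfolding L2_space_def \<phi>_def[symmetric] by simp
qed

text \<open>
  The half-lines form an intersection-stable generator of the Borel sets, so, on each bounded window,
  vanishing of the integrals over intervals extends to all Borel sets by a Dynkin argument.
\<close>

lemma AE_zero_if_interval_integrals_zero:
  fixes f :: "real \<Rightarrow> complex"
  assumes int: "\<And>a b. a \<le> b \<Longrightarrow> integrable lborel (\<lambda>x. f x * indicator {a..b} x)"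
    and zero: "\<And>a b. a \<le> b \<Longrightarrow> (\<integral>x. f x * indicator {a..b} x \<partial>lborel) = 0"
  shows "AE x in lborel. f x = 0"
proof -
  have "AE x in lborel. f x * indicator {- real N..real N} x = 0" for N :: nat
  proof (rule sigma_finite_measure.density_zero[OF lborel.sigma_finite_measure_axioms])
    define h where "h x = f x * indicator {- real N..real N} x" for x
    have h: "integrable lborel h" unfolding h_def by (rule int) simp
    then have hA: "integrable lborel (\<lambda>x. indicator A x *\<^sub>R h x)" if "A \<in> sets borel" for A
      using that by (intro integrable_mult_indicator) auto
    fix A :: "real set" assume "A \<in> sets lborel"
    then have A: "A \<in> sigma_sets UNIV (range atMost)"
      by (simp add: borel_eq_atMost)
    have "Int_stable (range atMost :: real set set)"
      by (auto simp: Int_stable_def)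
    moreover have "range atMost \<subseteq> Pow (UNIV :: real set)" by simp
    moreover note A
    ultimately have "A \<in> sets borel \<and> (\<integral>x. indicator A x *\<^sub>R h x \<partial>lborel) = 0"
    proof (induction rule: sigma_sets_induct_disjoint)
      case (basic A)
      then obtain a where A: "A = {..a}" by auto
      have "(\<integral>x. indicator A x *\<^sub>R h x \<partial>lborel) = 0"
      proof (cases "- real N \<le> min a (real N)")
        case True
        have "(\<integral>x. indicator A x *\<^sub>R h x \<partial>lborel) =
              (\<integral>x. f x * indicator {- real N..min a (real N)} x \<partial>lborel)"
          unfolding h_def A by (intro Bochner_Integration.integral_cong) (auto simp: indicator_def)
        then show ?thesis using zero[OF True] by simp
      next
        case False
        then have "indicator A x *\<^sub>R h x = 0" for x
          unfolding h_def A by (auto simp: indicator_def)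
        then show ?thesis by (simp only: Bochner_Integration.integral_zero)
      qed
      with A show ?case by simp
    next
      case empty
      show ?case by simp
    next
      case (compl A)
      have "(\<integral>x. h x \<partial>lborel) = 0" unfolding h_def by (rule zero) simp
      moreover have "indicator (UNIV - A) x *\<^sub>R h x = h x - indicator A x *\<^sub>R h x" for x
        by (auto simp: indicator_def)
      ultimately show ?case using compl h hA by (simp add: sets.Diff)
    next
      case (union A)
      then have "(\<integral>x\<in>(\<Union>i. A i). h x \<partial>lborel) = (\<Sum>i. \<integral>x\<in>A i. h x \<partial>lborel)"
        by (intro lebesgue_integral_countable_add)
           (auto simp: disjoint_family_on_def set_integrable_def intro!: hA)
      then show ?case using union by (auto simp: set_lebesgue_integral_def)
    qed
    then show "set_lebesgue_integral lborel A (\<lambda>x. f x * indicator {- real N..real N} x) = 0"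
      by (simp add: set_lebesgue_integral_def h_def)
  qed (rule int, simp)
  then have "AE x in lborel. \<forall>N::nat. f x * indicator {- real N..real N} x = 0"
    by (intro AE_all_countable[THEN iffD2] allI)
  then show ?thesis
  proof eventually_elim
    case (elim x)
    obtain N :: nat where "\<bar>x\<bar> \<le> real N" using real_arch_simple by blast
    then have "x \<in> {- real N..real N}" by auto
    then show "f x = 0" using elim[rule_format, of N] by (simp add: indicator_def split: if_splits)
  qed
qed

text \<open>
  The transform on \<open>L\<^sup>2\<close> is a limit of transforms of approximants \<open>F n\<close>. Tested against the indicator \<open>\<phi>\<close>
  of an interval, the integral of \<open>fourier (F n) * \<phi>\<close> equals that of \<open>F n * fourier \<phi>\<close>; both functions
  \<open>\<phi>\<close> and \<open>fourier \<phi>\<close> are square integrable, so both sides pass to the limit. Hence \<open>h\<close> and \<open>fourier g\<close>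
  have the same integral over every interval.
\<close>

lemma is_fourier_L2_eq_fourier:
  assumes g: "integrable lborel g" and F: "is_fourier_L2 g h"
  shows "AE x in lborel. h x = fourier g x"
proof -
  obtain F where gL: "g \<in> L2_space" and hL: "h \<in> L2_space"
    and F: "\<And>n. F n \<in> L1_space" "\<And>n. F n \<in> L2_space"
    and lim1: "(\<lambda>n. L2_dist_sq (F n) g) \<longlonglongrightarrow> 0"
    and lim2: "(\<lambda>n. L2_dist_sq (fourier (F n)) h) \<longlonglongrightarrow> 0"
    using F unfolding is_fourier_L2_def by blast
  have FI: "integrable lborel (F n)" for n using F(1)[of n] by (simp add: L1_space_def)
  have ind: "indicator {a..b} \<in> L2_space" "integrable lborel (indicator {a..b} :: real \<Rightarrow> complex)"
      for a b :: real
  proof -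
    have "(\<lambda>x. (cmod (indicator {a..b} x))\<^sup>2) = indicat_real {a..b}" by (auto simp: indicator_def)
    moreover have "integrable lborel (indicat_real {a..b})"
      by (intro integrable_real_indicator) (auto simp: emeasure_lborel_Icc_eq)
    ultimately show "indicator {a..b} \<in> L2_space" unfolding L2_space_def by simp
    show "integrable lborel (indicator {a..b} :: real \<Rightarrow> complex)"
      by (rule integrable_indicator_complex)
  qed
  have bint: "integrable lborel (\<lambda>x. fourier f x * indicator {a..b} x)"
    if f: "integrable lborel f" for f and a b :: real
  proof (rule Bochner_Integration.integrable_bound)
    note [measurable] = fourier_measurable[OF f]
    show "integrable lborel (\<lambda>x. indicat_real {a..b} x * (\<integral>x. cmod (f x) \<partial>lborel))"
      by (intro integrable_mult_left integrable_real_indicator) (auto simp: emeasure_lborel_Icc_eq)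
    show "(\<lambda>x. fourier f x * indicator {a..b} x) \<in> borel_measurable lborel" by simp
    show "AE x in lborel. cmod (fourier f x * indicator {a..b} x) \<le>
            norm (indicat_real {a..b} x * (\<integral>x. cmod (f x) \<partial>lborel))"
      using norm_fourier_le[OF f] by (auto simp: indicator_def intro: order_trans[OF _ abs_ge_self])
  qed
  have "AE x in lborel. h x - fourier g x = 0"
  proof (rule AE_zero_if_interval_integrals_zero)
    fix a b :: real assume ab: "a \<le> b"
    define \<phi> :: "real \<Rightarrow> complex" where "\<phi> = indicator {a..b}"
    have i: "integrable lborel (\<lambda>x. h x * \<phi> x)" "integrable lborel (\<lambda>x. fourier g x * \<phi> x)"
      unfolding \<phi>_def using L2_pairing_integrable[OF hL ind(1)] bint[OF g] by auto
    then show "integrable lborel (\<lambda>x. (h x - fourier g x) * indicator {a..b} x)"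
      using Bochner_Integration.integrable_diff[OF i] by (simp add: \<phi>_def left_diff_distrib)
    have lim3: "(\<lambda>n. \<integral>x. fourier (F n) x * \<phi> x \<partial>lborel) \<longlonglongrightarrow> (\<integral>x. h x * \<phi> x \<partial>lborel)"
      unfolding \<phi>_def by (rule L2_pairing_tendsto[OF bint[OF FI] fourier_measurable[OF FI] hL ind(1) lim2])
    moreover have "(\<integral>x. fourier (F n) x * \<phi> x \<partial>lborel) = (\<integral>x. F n x * fourier \<phi> x \<partial>lborel)" for n
      unfolding \<phi>_def by (rule integral_fourier_mult_commute[OF FI ind(2)])
    moreover have lim4: "(\<lambda>n. \<integral>x. F n x * fourier \<phi> x \<partial>lborel) \<longlonglongrightarrow> (\<integral>x. g x * fourier \<phi> x \<partial>lborel)"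
      unfolding \<phi>_def
      using F(2) L2_pairing_integrable[OF F(2) fourier_indicator_L2[OF ab]]
      by (intro L2_pairing_tendsto[OF _ _ gL fourier_indicator_L2[OF ab] lim1])
         (simp_all only: L2_space_nn_integral)
    ultimately have "(\<integral>x. h x * \<phi> x \<partial>lborel) = (\<integral>x. g x * fourier \<phi> x \<partial>lborel)"
      by (intro LIMSEQ_unique[OF lim3]) simp
    also have "\<dots> = (\<integral>x. fourier g x * \<phi> x \<partial>lborel)"
      unfolding \<phi>_def by (rule integral_fourier_mult_commute[OF g ind(2), symmetric])
    finally show "(\<integral>x. (h x - fourier g x) * indicator {a..b} x \<partial>lborel) = 0"
      using Bochner_Integration.integral_diff[OF i] by (simp add: \<phi>_def left_diff_distrib)
  qed
  then show ?thesis by simp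
qed

section \<open>Functions in the Wiener space\<close>

lemma wiener_local_esssup_finite:
  assumes "g \<in> wiener_space"
  shows "local_esssup g k < \<infinity>"
proof -
  have "local_esssup g k = (\<Sum>\<^sub>\<infinity>k\<in>{k}. local_esssup g k)" by simp
  also have "\<dots> \<le> (\<Sum>\<^sub>\<infinity>k\<in>UNIV. local_esssup g k)"
    by (rule infsum_mono_neutral) (auto intro: nonneg_summable_on_complete)
  also have "\<dots> < \<infinity>" using assms by (simp add: wiener_space_def)
  finally show ?thesis .
qed

lemma wiener_local_esssup_summable:
  assumes g: "g \<in> wiener_space"
  shows "(\<lambda>k. enn2real (local_esssup g k)) summable_on UNIV"
proof (rule nonneg_bdd_above_summable_on[OF enn2real_nonneg], rule bdd_aboveI)
  define S where "S = (\<Sum>\<^sub>\<infinity>k\<in>UNIV. local_esssup g k)"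
  have S: "S < \<infinity>" using g by (simp add: wiener_space_def S_def)
  fix y assume "y \<in> sum (\<lambda>k. enn2real (local_esssup g k)) ` {F. F \<subseteq> UNIV \<and> finite F}"
  then obtain F where F: "finite F" and y: "y = (\<Sum>k\<in>F. enn2real (local_esssup g k))" by auto
  have "ennreal y = (\<Sum>k\<in>F. ennreal (enn2real (local_esssup g k)))"
    unfolding y by (rule sum_ennreal[symmetric]) simp
  also have "\<dots> = (\<Sum>\<^sub>\<infinity>k\<in>F. local_esssup g k)"
    using F wiener_local_esssup_finite[OF g] by simp
  also have "\<dots> \<le> S" unfolding S_def
    by (rule infsum_mono_neutral) (auto intro: nonneg_summable_on_complete)
  also have "S = ennreal (enn2real S)" using S by simp
  finally show "y \<le> enn2real S" by (simp add: ennreal_le_iff)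
qed

lemma AE_translate:
  fixes c :: real
  assumes P: "AE x in lborel. P x" "{x. P x} \<in> sets borel"
  shows "AE x in lborel. P (x + c)"
proof -
  have "AE x in distr lborel borel ((+) c). P x"
    using P(1) by (simp only: lborel_distr_plus)
  then show ?thesis using P(2) by (subst (asm) AE_distr_iff) (auto simp: add.commute)
qed

lemma wiener_AE_le:
  assumes g: "g \<in> wiener_space"
  shows "AE x in lborel. cmod (g x) \<le> enn2real (local_esssup g \<lfloor>x\<rfloor>)"
proof -
  have [measurable]: "g \<in> borel_measurable borel" using g by (simp add: wiener_space_def)
  have "AE x in lborel. x \<in> {of_int k..of_int k + 1} \<longrightarrow> cmod (g x) \<le> enn2real (local_esssup g k)" for k :: int
  proof -
    define a where "a = enn2real (local_esssup g k)"
    have a: "local_esssup g k = ennreal a" "0 \<le> a"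
      using wiener_local_esssup_finite[OF g] by (auto simp: a_def)
    have "AE x in restrict_space lborel {0..1}. ennreal (cmod (g (x + of_int k))) \<le> ennreal a"
      unfolding a(1)[symmetric] local_esssup_def by (rule esssup_AE)
    then have "AE x in lborel. x \<in> {0..1} \<longrightarrow> cmod (g (x + of_int k)) \<le> a"
      using a(2) by (simp add: AE_restrict_space_iff)
    then have "AE x in lborel. x - of_int k \<in> {0..1} \<longrightarrow> cmod (g (x - of_int k + of_int k)) \<le> a"
      using AE_translate[of "\<lambda>x. x \<in> {0..1} \<longrightarrow> cmod (g (x + of_int k)) \<le> a" "- of_int k"] by simp
    then show ?thesis unfolding a_def by eventually_elim (auto simp: algebra_simps)
  qed
  then have "AE x in lborel. \<forall>k::int. x \<in> {of_int k..of_int k + 1} \<longrightarrow> cmod (g x) \<le> enn2real (local_esssup g k)"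
    by (intro AE_all_countable[THEN iffD2] allI)
  then show ?thesis
  proof eventually_elim
    case (elim x)
    have "x \<in> {of_int \<lfloor>x\<rfloor>..of_int \<lfloor>x\<rfloor> + 1}" by (auto intro: less_imp_le)
    then show ?case using elim by blast
  qed
qed

text \<open>
  Integrability of Wiener functions, and of the functions that are periodized below, is reduced to
  majorants that are constant on the intervals \<open>[k, k + 1)\<close>.
\<close>

lemma integrable_step_function:
  fixes a :: "int \<Rightarrow> real"
  assumes a: "\<And>k. 0 \<le> a k" and sum: "a summable_on UNIV"
  shows "integrable lborel (\<lambda>x::real. a \<lfloor>x\<rfloor>)"
proof -
  define A :: "nat \<Rightarrow> real set" where "A i = {of_int (int_decode i)..<of_int (int_decode i) + 1}" for i
  have A: "x \<in> A i \<longleftrightarrow> i = int_encode \<lfloor>x\<rfloor>" for x i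
  proof -
    have "x \<in> A i \<longleftrightarrow> \<lfloor>x\<rfloor> = int_decode i" unfolding A_def by (auto simp: floor_eq_iff)
    also have "\<dots> \<longleftrightarrow> i = int_encode \<lfloor>x\<rfloor>" by (metis int_decode_inverse int_encode_inverse)
    finally show ?thesis .
  qed
  have [measurable]: "A i \<in> sets borel" for i unfolding A_def by simp
  have [measurable]: "(\<lambda>x::real. a \<lfloor>x\<rfloor>) \<in> borel_measurable borel"
    by (rule measurable_compose[of "floor" borel "count_space UNIV"]) simp_all
  have eq: "ennreal (a \<lfloor>x\<rfloor>) = (\<Sum>i. ennreal (a (int_decode i)) * indicator (A i) x)" for x
  proof -
    have "(\<Sum>i. ennreal (a (int_decode i)) * indicator (A i) x) =
          (\<Sum>i\<in>{int_encode \<lfloor>x\<rfloor>}. ennreal (a (int_decode i)) * indicator (A i) x)"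
      by (rule suminf_finite) (auto simp: A)
    then show ?thesis by (simp add: A)
  qed
  have "(a \<circ> int_decode) summable_on UNIV"
    using sum summable_on_reindex_bij_betw[OF bij_int_decode, of a] by (simp add: o_def)
  then have s: "summable (\<lambda>i. a (int_decode i))"
    by (auto dest: summable_on_imp_summable simp: o_def)
  have "(\<integral>\<^sup>+x. ennreal (a \<lfloor>x::real\<rfloor>) \<partial>lborel) = (\<Sum>i. ennreal (a (int_decode i)))"
    by (simp only: eq, subst nn_integral_suminf) (auto simp: nn_integral_cmult_indicator A_def)
  also have "\<dots> = ennreal (\<Sum>i. a (int_decode i))" using s a by (intro suminf_ennreal2) auto
  also have "\<dots> < \<infinity>" by simp
  finally show ?thesis using a by (intro integrableI_bounded) auto
qed

lemma wiener_integrable: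
  assumes g: "g \<in> wiener_space"
  shows "integrable lborel g"
proof (rule Bochner_Integration.integrable_bound)
  show "integrable lborel (\<lambda>x::real. enn2real (local_esssup g \<lfloor>x\<rfloor>))"
    by (intro integrable_step_function wiener_local_esssup_summable g) simp
  show "AE x in lborel. cmod (g x) \<le> norm (enn2real (local_esssup g \<lfloor>x\<rfloor>))"
    using wiener_AE_le[OF g] by simp
qed (use g in \<open>simp add: wiener_space_def\<close>)

lemma wiener_space_cong_AE:
  assumes g: "g \<in> wiener_space" and h: "h \<in> borel_measurable borel" and eq: "AE x in lborel. h x = g x"
  shows "h \<in> wiener_space"
proof -
  have [measurable]: "g \<in> borel_measurable borel" "h \<in> borel_measurable borel"
    using g h by (auto simp: wiener_space_def)
  have "local_esssup h k = local_esssup g k" for k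
    unfolding local_esssup_def
  proof (rule esssup_AE_cong)
    have "AE x in lborel. h (x + of_int k) = g (x + of_int k)"
      by (rule AE_translate[OF eq]) measurable
    then have "AE x in restrict_space lborel {0..1}. h (x + of_int k) = g (x + of_int k)"
      by (subst AE_restrict_space_iff) (auto elim: eventually_mono)
    then show "AE x in restrict_space lborel {0..1}.
        ennreal (cmod (h (x + of_int k))) = ennreal (cmod (g (x + of_int k)))"
      by eventually_elim simp
  qed (intro measurable_restrict_space1; simp)+
  moreover have "esssup lborel (\<lambda>x. ennreal (cmod (h x))) = esssup lborel (\<lambda>x. ennreal (cmod (g x)))"
    by (rule esssup_AE_cong) (use eq in auto)
  ultimately show ?thesis using g unfolding wiener_space_def by (simp cong: infsum_cong)
qed

text \<open>
  An eigenfunction \<open>g\<close> in the Wiener space is integrable, so \<open>fourier g / (- \<i>) ^ j\<close> is a continuous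
  function that agrees with \<open>g\<close> almost everywhere. The integral defining the transform does not see null
  sets, and therefore the eigenvalue equation holds at every point for this representative.
\<close>

lemma continuous_rep_eigenfunction:
  assumes g: "g \<in> fourier_eigenspace j" "g \<in> wiener_space"
  shows "continuous_on UNIV (continuous_rep g)"
    and "continuous_rep g \<in> wiener_space"
    and "fourier (continuous_rep g) = (\<lambda>t. (- \<i>) ^ j * continuous_rep g t)"
proof -
  define c where "c = (- \<i>) ^ j"
  have c: "c \<noteq> 0" by (simp add: c_def)
  define h where "h t = fourier g t / c" for t
  have gi: "integrable lborel g" by (rule wiener_integrable[OF g(2)])
  have "AE x in lborel. c * g x = fourier g x"
    using is_fourier_L2_eq_fourier[OF gi, of "\<lambda>x. c * g x"] g(1)
    by (simp add: fourier_eigenspace_def c_def)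
  then have eq: "AE x in lborel. h x = g x"
    by eventually_elim (use c in \<open>simp add: h_def field_simps\<close>)
  have cont: "continuous_on UNIV h"
    unfolding h_def using c by (intro continuous_intros continuous_fourier gi) auto
  have hm: "h \<in> borel_measurable borel" by (rule borel_measurable_continuous_onI[OF cont])
  have rep: "continuous_rep g = h" by (rule continuous_rep_eqI[OF cont eq])
  show "continuous_on UNIV (continuous_rep g)" using cont rep by simp
  show "continuous_rep g \<in> wiener_space"
    unfolding rep by (rule wiener_space_cong_AE[OF g(2) hm eq])
  have "fourier h = fourier g"
    using eq hm gi by (intro fourier_cong_AE) auto
  then show "fourier (continuous_rep g) = (\<lambda>t. (- \<i>) ^ j * continuous_rep g t)"
    unfolding rep using c by (simp add: h_def c_def[symmetric])
qed

section \<open>Uniqueness of Fourier coefficients\<close>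

lemma cos_2pi_le:
  assumes "0 \<le> d" "d \<le> \<bar>y\<bar>" "\<bar>y\<bar> \<le> 1 - d"
  shows "cos (2 * pi * y) \<le> cos (2 * pi * d)"
proof -
  have abs: "cos (2 * pi * y) = cos (2 * pi * \<bar>y\<bar>)"
    using cos_abs_real[of "2 * pi * y"] by (simp add: abs_mult)
  show ?thesis
  proof (cases "\<bar>y\<bar> \<le> 1 / 2")
    case True
    then show ?thesis unfolding abs using assms
      by (intro cos_monotone_0_pi_le) (auto simp: mult_left_mono)
  next
    case False
    have "cos (2 * pi * \<bar>y\<bar>) = cos (2 * pi * (1 - \<bar>y\<bar>))"
      by (simp add: right_diff_distrib cos_diff)
    also have "\<dots> \<le> cos (2 * pi * d)" using assms False
      by (intro cos_monotone_0_pi_le mult_left_mono) (auto simp: field_simps)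
    finally show ?thesis using abs by simp
  qed
qed

text \<open>
  A power of \<open>\<beta> + cos (2 \<pi> (x - x0))\<close> is a trigonometric polynomial; the induction on the exponent needs
  the additional frequency \<open>n\<close>, because multiplication by the cosine shifts it by one in both directions.
\<close>

lemma integral_01_mult_cos_power_eq_0:
  fixes D :: "real \<Rightarrow> complex"
  assumes cont: "continuous_on {0..1} D"
    and moments: "\<And>n :: int. integral {0..1} (\<lambda>x. D x * cis (2 * pi * of_int n * x)) = 0"
  shows "integral {0..1} (\<lambda>x. D x * of_real ((\<beta> + cos (2 * pi * (x - x0))) ^ m)
           * cis (2 * pi * of_int n * x)) = 0"
proof (induction m arbitrary: n)
  case 0
  then show ?case using moments by simp
next
  case (Suc m)
  define w where "w x = \<beta> + cos (2 * pi * (x - x0))" for x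
  define I where "I n x = D x * of_real (w x ^ m) * cis (2 * pi * of_int n * x)" for n :: int and x
  have cI: "I n integrable_on {0..1}" for n
    unfolding I_def w_def by (intro integrable_continuous_interval continuous_intros cont)
  have zero: "integral {0..1} (I n) = 0" for n
    using Suc.IH[of n] unfolding I_def w_def by simp
  have w: "of_real (w x) = of_real \<beta> + (cis (2 * pi * x) * cis (- (2 * pi * x0))
              + cis (- (2 * pi * x)) * cis (2 * pi * x0)) / 2" for x
    unfolding w_def by (auto simp: complex_eq_iff cos_diff sin_diff right_diff_distrib algebra_simps)
  have shift: "cis (2 * pi * x) * cis (2 * pi * of_int n * x) = cis (2 * pi * of_int (n + 1) * x)"
    "cis (- (2 * pi * x)) * cis (2 * pi * of_int n * x) = cis (2 * pi * of_int (n - 1) * x)" for x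
    by (simp_all add: cis_mult algebra_simps)
  have eq: "D x * of_real (w x ^ Suc m) * cis (2 * pi * of_int n * x) =
      of_real \<beta> * I n x + (cis (- (2 * pi * x0)) / 2) * I (n + 1) x
        + (cis (2 * pi * x0) / 2) * I (n - 1) x" for x
  proof -
    have "D x * of_real (w x ^ Suc m) * cis (2 * pi * of_int n * x)
        = D x * of_real (w x ^ m) * cis (2 * pi * of_int n * x) * of_real (w x)" by (simp add: mult_ac)
    then show ?thesis unfolding w I_def shift[symmetric] by (simp add: algebra_simps)
  qed
  have "integral {0..1} (\<lambda>x. D x * of_real (w x ^ Suc m) * cis (2 * pi * of_int n * x)) =
      of_real \<beta> * integral {0..1} (I n) + (cis (- (2 * pi * x0)) / 2) * integral {0..1} (I (n + 1))
        + (cis (2 * pi * x0) / 2) * integral {0..1} (I (n - 1))"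
    unfolding eq using cI
    by (subst integral_add; (subst integral_add)?)
       (auto intro!: integrable_add integrable_on_mult_right)
  then show ?case unfolding w_def by (simp add: zero)
qed

text \<open>
  If \<open>D x0\<close> were nonzero, then \<open>E x = Re (cnj (D x0) * D x)\<close> would be positive near \<open>x0\<close>. The powers of
  \<open>w x = 1 - cos (2 \<pi> \<delta>) + cos (2 \<pi> (x - x0))\<close> on the unit interval are at most 1 in absolute
  value at distance at least \<open>\<delta>\<close> from \<open>x0\<close>, but grow geometrically within distance \<open>\<delta> / 2\<close>.
  So the integrals of \<open>E * w ^ m\<close> would tend to infinity, whereas they vanish by the previous lemma. This needs \<open>x0\<close> in the interior, as the cosine
  does not separate 0 and 1; the end points follow by continuity.
\<close>

lemma zero_if_fourier_coefficients_zero: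
  fixes D :: "real \<Rightarrow> complex"
  assumes cont: "continuous_on {0..1} D"
    and moments: "\<And>n :: int. integral {0..1} (\<lambda>x. D x * cis (2 * pi * of_int n * x)) = 0"
    and x: "x \<in> {0..1}"
  shows "D x = 0"
proof -
  have interior: "D x0 = 0" if x0: "0 < x0" "x0 < 1" for x0
  proof (rule ccontr)
    assume nz: "D x0 \<noteq> 0"
    define E where "E x = Re (cnj (D x0) * D x)" for x
    have cE: "continuous_on {0..1} E" unfolding E_def by (intro continuous_intros cont)
    define e where "e = E x0"
    have e: "e > 0" using nz unfolding e_def E_def
      by (simp add: complex_eq_iff sum_squares_gt_zero_iff)
    obtain \<delta>' where \<delta>': "\<delta>' > 0" "\<And>x. x \<in> {0..1} \<Longrightarrow> \<bar>x - x0\<bar> < \<delta>' \<Longrightarrow> \<bar>E x - E x0\<bar> < e / 2"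
      using cE x0 e unfolding continuous_on_iff dist_real_def
      by (metis atLeastAtMost_iff half_gt_zero less_imp_le)
    define \<delta> where "\<delta> = min (\<delta>' / 2) (min x0 (1 - x0) / 2)"
    have \<delta>: "0 < \<delta>" "\<delta> < \<delta>'" "\<delta> < x0" "\<delta> < 1 - x0" "\<delta> < 1 / 2"
      using \<delta>'(1) x0 unfolding \<delta>_def by (auto simp: min_def)
    obtain K where K: "\<And>x. x \<in> {0..1} \<Longrightarrow> \<bar>E x\<bar> \<le> K"
      using compact_imp_bounded[OF compact_continuous_image[OF cE compact_Icc]]
      unfolding bounded_iff by (metis imageI real_norm_def)
    have K0: "0 \<le> K" using K[of 0] by auto
    define w where "w x = (1 - cos (2 * pi * \<delta>)) + cos (2 * pi * (x - x0))" for x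
    define \<rho> where "\<rho> = 1 - cos (2 * pi * \<delta>) + cos (2 * pi * (\<delta> / 2))"
    have \<rho>: "\<rho> > 1"
    proof -
      have "cos (2 * pi * \<delta>) < cos (2 * pi * (\<delta> / 2))"
        using \<delta> by (intro cos_monotone_0_pi) (auto simp: field_simps)
      then show ?thesis by (simp add: \<rho>_def)
    qed
    define J where "J = {x0 - \<delta> / 2..x0 + \<delta> / 2}"
    have J: "J \<subseteq> {0..1}" using \<delta> x0 by (auto simp: J_def)
    have lower: "E x * w x ^ m + K \<ge> (if x \<in> J then e / 2 * \<rho> ^ m else 0)" if x: "x \<in> {0..1}" for x m
    proof (cases "\<bar>x - x0\<bar> < \<delta>")
      case True
      have E: "e / 2 < E x" using \<delta>'(2)[OF x] True \<delta>(2) unfolding e_def abs_less_iff by auto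
      have ww: "w x \<ge> 1 - cos (2 * pi * \<delta>) + cos (2 * pi * d)" if "\<bar>x - x0\<bar> \<le> d" "d \<le> \<delta>" for d
      proof -
        have "cos (2 * pi * d) \<le> cos (2 * pi * \<bar>x - x0\<bar>)"
          using that \<delta> by (intro cos_monotone_0_pi_le) (auto simp: field_simps)
        also have "\<dots> = cos (2 * pi * (x - x0))"
          using cos_abs_real[of "2 * pi * (x - x0)"] by (simp add: abs_mult)
        finally show ?thesis by (simp add: w_def)
      qed
      have w1: "w x \<ge> 1" using ww[of \<delta>] True by simp
      show ?thesis
      proof (cases "x \<in> J")
        case True
        then have "\<bar>x - x0\<bar> \<le> \<delta> / 2" unfolding J_def atLeastAtMost_iff abs_le_iff by linarith
        then have "\<rho> \<le> w x" using ww[of "\<delta> / 2"] \<delta> by (simp add: \<rho>_def)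
        then have "\<rho> ^ m \<le> w x ^ m" using \<rho> by (intro power_mono) auto
        then have "e / 2 * \<rho> ^ m \<le> E x * w x ^ m" using E e \<rho> by (intro mult_mono) auto
        then show ?thesis using True K0 by simp
      next
        case False
        have "0 \<le> E x * w x ^ m" using E e w1 by (intro mult_nonneg_nonneg) auto
        then show ?thesis using False K0 by simp
      qed
    next
      case False
      have "cos (2 * pi * (x - x0)) \<le> cos (2 * pi * \<delta>)"
        using False x \<delta> by (intro cos_2pi_le) auto
      then have "\<bar>w x\<bar> \<le> 1" unfolding w_def
        using cos_ge_minus_one[of "2 * pi * (x - x0)"] cos_le_one[of "2 * pi * \<delta>"] by linarith
      then have "\<bar>w x ^ m\<bar> \<le> 1" by (simp add: power_abs power_le_one)
      then have "\<bar>E x * w x ^ m\<bar> \<le> K * 1" unfolding abs_mult using K[OF x] by (intro mult_mono) auto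
      moreover have "x \<notin> J" using False \<delta> by (auto simp: J_def)
      ultimately show ?thesis by auto
    qed
    have cw: "continuous_on A (\<lambda>x. w x ^ m)" for A m unfolding w_def by (intro continuous_intros)
    have zero: "integral {0..1} (\<lambda>x. E x * w x ^ m) = 0" for m
    proof -
      have "((\<lambda>x. D x * of_real (w x ^ m)) has_integral 0) {0..1}"
        using integral_01_mult_cos_power_eq_0[OF cont moments, of "1 - cos (2 * pi * \<delta>)" x0 m 0]
          integrable_integral[OF integrable_continuous_interval[OF
            continuous_on_mult[OF cont continuous_on_of_real[OF cw[of _ m]]]]]
        unfolding w_def by simp
      then have "((\<lambda>x. cnj (D x0) * (D x * of_real (w x ^ m))) has_integral cnj (D x0) * 0) {0..1}"
        by (rule has_integral_mult_right)
      then have "((\<lambda>x. Re (cnj (D x0) * (D x * of_real (w x ^ m)))) has_integral Re (cnj (D x0) * 0)) {0..1}"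
        by (rule has_integral_Re)
      moreover have "Re (cnj (D x0) * (D x * of_real (w x ^ m))) = E x * w x ^ m" for x
        unfolding E_def mult.assoc[symmetric] by (simp del: of_real_power)
      ultimately show ?thesis by (simp add: integral_unique)
    qed
    have bound: "e / 2 * \<delta> * \<rho> ^ m \<le> K" for m
    proof -
      have i: "(\<lambda>x. E x * w x ^ m + K) integrable_on A" if "A = {0..1} \<or> A = J" for A
        using that J unfolding J_def
        by (auto intro!: integrable_continuous_interval continuous_intros cw
              intro: continuous_on_subset[OF cE])
      have nonneg: "0 \<le> E x * w x ^ m + K" if "x \<in> {0..1}" for x
      proof -
        have "0 \<le> (if x \<in> J then e / 2 * \<rho> ^ m else 0)" using e \<rho> by simp
        then show ?thesis using lower[OF that, of m] by linarith
      qed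
      have "e / 2 * \<delta> * \<rho> ^ m = integral J (\<lambda>x. e / 2 * \<rho> ^ m)"
        using \<delta>(1) by (simp add: J_def)
      also have "\<dots> \<le> integral J (\<lambda>x. E x * w x ^ m + K)"
      proof (rule integral_le)
        fix x assume x: "x \<in> J"
        then show "e / 2 * \<rho> ^ m \<le> E x * w x ^ m + K" using lower[of x m] J by auto
      qed (use i in \<open>auto simp: J_def\<close>)
      also have "\<dots> \<le> integral {0..1} (\<lambda>x. E x * w x ^ m + K)"
        using J i nonneg by (intro integral_subset_le) auto
      also have "\<dots> = integral {0..1} (\<lambda>x. E x * w x ^ m) + integral {0..1} (\<lambda>x::real. K)"
        by (intro integral_add integrable_continuous_interval continuous_intros cE cw)
      finally show ?thesis by (simp add: zero)
    qed
    obtain m where "K / (e / 2 * \<delta>) < \<rho> ^ m" using real_arch_pow[OF \<rho>] by blast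
    then have "K < e / 2 * \<delta> * \<rho> ^ m" using e \<delta>(1) by (simp add: field_simps)
    then show False using bound[of m] by simp
  qed
  have "closure {0<..<1::real} = {0..1}" by simp
  then show ?thesis
    using continuous_constant_on_closure[of "{0<..<1::real}" D 0 x] cont x interior by auto
qed

section \<open>Poisson summation\<close>

lemma integral_cis_01:
  "integral {0..1} (\<lambda>x. cis (2 * pi * of_int k * x)) = (if k = 0 then 1 else 0)"
proof (cases "k = 0")
  case False
  define G where "G x = - \<i> / (2 * pi * of_int k) * cis (2 * pi * of_int k * x)" for x :: real
  have "((\<lambda>x. cis (2 * pi * of_int k * x)) has_integral (G 1 - G 0)) {0..1}"
  proof (rule fundamental_theorem_of_calculus)
    fix x :: real
    show "(G has_vector_derivative cis (2 * pi * of_int k * x)) (at x within {0..1})"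
      unfolding G_def using False
      by (auto intro!: derivative_eq_intros simp: has_vector_derivative_complex_iff)
  qed simp
  moreover have "cis (2 * pi * of_int k) = 1" by (rule cis_multiple_2pi) simp
  ultimately show ?thesis using False by (simp add: G_def integral_unique)
qed simp

lemma
  fixes f :: "'i \<Rightarrow> real \<Rightarrow> complex"
  assumes cont: "\<And>k. continuous_on {a..b} (f k)"
    and bound: "\<And>k x. x \<in> {a..b} \<Longrightarrow> cmod (f k x) \<le> M k"
    and M: "M summable_on UNIV"
  shows continuous_on_infsum: "continuous_on {a..b} (\<lambda>x. \<Sum>\<^sub>\<infinity>k. f k x)"
    and has_sum_integral: "((\<lambda>k. integral {a..b} (f k)) has_sum integral {a..b} (\<lambda>x. \<Sum>\<^sub>\<infinity>k. f k x)) UNIV"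
proof -
  have lim: "uniform_limit {a..b} (\<lambda>F x. \<Sum>k\<in>F. f k x) (\<lambda>x. \<Sum>\<^sub>\<infinity>k. f k x) (finite_subsets_at_top UNIV)"
    by (rule Weierstrass_m_test_general[OF bound M]) auto
  show "continuous_on {a..b} (\<lambda>x. \<Sum>\<^sub>\<infinity>k. f k x)"
    by (rule uniform_limit_theorem[OF _ lim])
       (auto intro!: always_eventually continuous_on_sum cont)
  obtain I J where I: "\<And>F. ((\<lambda>x. \<Sum>k\<in>F. f k x) has_integral I F) {a..b}"
    and J: "((\<lambda>x. \<Sum>\<^sub>\<infinity>k. f k x) has_integral J) {a..b}" "(I \<longlongrightarrow> J) (finite_subsets_at_top UNIV)"
    by (rule uniform_limit_integral[OF lim]) (auto intro!: continuous_on_sum cont)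
  have "(\<Sum>k\<in>F. integral {a..b} (f k)) = I F" if "finite F" for F
  proof -
    have "integral {a..b} (\<lambda>x. \<Sum>k\<in>F. f k x) = (\<Sum>k\<in>F. integral {a..b} (f k))"
      using that by (intro integral_sum integrable_continuous_interval cont)
    then show ?thesis using I[of F] by (simp add: integral_unique)
  qed
  then have "((\<lambda>F. \<Sum>k\<in>F. integral {a..b} (f k)) \<longlongrightarrow> J) (finite_subsets_at_top UNIV)"
    by (intro Lim_transform_eventually[OF J(2)] eventually_finite_subsets_at_top_weakI) simp
  then show "((\<lambda>k. integral {a..b} (f k)) has_sum integral {a..b} (\<lambda>x. \<Sum>\<^sub>\<infinity>k. f k x)) UNIV"
    using J(1) by (simp add: has_sum_def integral_unique)
qed

text \<open>
  The line is cut into the intervals \<open>[k, k + 1)\<close>. The summable majorant \<open>M\<close> gives integrability on the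
  line and permits the interchange of sum and integral.
\<close>

lemma integral_periodization:
  fixes u :: "real \<Rightarrow> complex"
  assumes cont: "continuous_on UNIV u"
    and bound: "\<And>k x. x \<in> {0..1} \<Longrightarrow> cmod (u (x + of_int k)) \<le> M k"
    and M: "M summable_on UNIV"
  shows "integral {0..1} (\<lambda>x. \<Sum>\<^sub>\<infinity>k. u (x + of_int k)) = (\<integral>x. u x \<partial>lborel)"
proof -
  have cont': "continuous_on A (\<lambda>x. u (x + of_int k))" for k :: int and A
    by (intro continuous_on_compose2[OF cont] continuous_intros) auto
  have M0: "0 \<le> M k" for k using order_trans[OF norm_ge_zero bound[of 0 k]] by simp
  have [measurable]: "u \<in> borel_measurable borel" by (rule borel_measurable_continuous_onI[OF cont])
  have int: "integrable lborel u"
  proof (rule Bochner_Integration.integrable_bound[OF integrable_step_function[OF M0 M]])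
    have "cmod (u x) \<le> M \<lfloor>x\<rfloor>" for x
      using bound[of "x - of_int \<lfloor>x\<rfloor>" "\<lfloor>x\<rfloor>"] by (simp; linarith)
    then show "AE x in lborel. cmod (u x) \<le> norm (M \<lfloor>x\<rfloor>)" using M0 by auto
  qed simp
  define A :: "int \<Rightarrow> real set" where "A k = {of_int k..<of_int k + 1}" for k
  define c where "c k = integral {0..1} (\<lambda>x. u (x + of_int k))" for k :: int
  have c: "(\<integral>x\<in>A k. u x \<partial>lborel) = c k" for k
  proof -
    have "(\<integral>x\<in>A k. u x \<partial>lborel) = (\<integral>x. indicator {of_int k..of_int k + 1} x *\<^sub>R u x \<partial>lborel)"
      unfolding set_lebesgue_integral_def
    proof (rule integral_cong_AE)
      have "AE x in lborel. x \<noteq> of_int k + (1 :: real)" by (rule AE_lborel_singleton)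
      then show "AE x in lborel. indicat_real (A k) x *\<^sub>R u x = indicat_real {of_int k..of_int k + 1} x *\<^sub>R u x"
        by eventually_elim (auto simp: A_def indicator_def)
    qed (simp_all add: A_def)
    also have "\<dots> = (\<integral>x. indicator {of_int k..of_int k + 1} (of_int k + 1 * x) *\<^sub>R u (of_int k + 1 * x) \<partial>lborel)"
      by (subst lborel_integral_real_affine[where c=1 and t="of_int k"]) simp_all
    also have "\<dots> = (\<integral>x\<in>{0..1}. u (x + of_int k) \<partial>lborel)"
      unfolding set_lebesgue_integral_def
      by (intro Bochner_Integration.integral_cong) (auto simp: indicator_def add.commute)
    also have "\<dots> = c k" unfolding c_def
      by (intro set_borel_integral_eq_integral borel_integrable_atLeastAtMost')  (rule cont')
    finally show ?thesis .
  qed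
  have "(\<lambda>k. norm (c k)) summable_on UNIV"
  proof (rule summable_on_comparison_test[OF M])
    fix k
    have "norm (c k) \<le> M k * (1 - 0)"
      unfolding c_def by (intro integral_bound cont' bound) auto
    then show "norm (c k) \<le> M k" by simp
  qed simp
  then have "(c has_sum infsum c UNIV) UNIV"
    by (rule has_sum_infsum[OF abs_summable_summable])
  then have "((\<lambda>i. c (int_decode i)) has_sum infsum c UNIV) UNIV"
    by (simp only: has_sum_reindex_bij_betw[OF bij_int_decode])
  then have "(\<lambda>i. c (int_decode i)) sums infsum c UNIV" by (rule has_sum_imp_sums)
  then have "infsum c UNIV = (\<Sum>i. \<integral>x\<in>A (int_decode i). u x \<partial>lborel)"
    unfolding c by (rule sums_unique)
  also have "\<dots> = (\<integral>x\<in>(\<Union>i. A (int_decode i)). u x \<partial>lborel)"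
  proof (rule lebesgue_integral_countable_add[symmetric])
    fix i j :: nat assume "i \<noteq> j"
    then have ne: "int_decode i \<noteq> int_decode j" by (metis int_decode_inverse)
    show "A (int_decode i) \<inter> A (int_decode j) = {}"
    proof (rule ccontr)
      assume "A (int_decode i) \<inter> A (int_decode j) \<noteq> {}"
      then obtain x where "x \<in> A (int_decode i)" "x \<in> A (int_decode j)" by auto
      then have "\<lfloor>x\<rfloor> = int_decode i" "\<lfloor>x\<rfloor> = int_decode j" by (auto simp: A_def floor_eq_iff)
      with ne show False by simp
    qed
  next
    show "set_integrable lborel (\<Union>i. A (int_decode i)) u"
      unfolding set_integrable_def by (rule integrable_mult_indicator[OF _ int]) (auto simp: A_def)
  qed (simp add: A_def)
  also have "(\<Union>i. A (int_decode i)) = UNIV"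
  proof -
    have "x \<in> A (int_decode (int_encode \<lfloor>x\<rfloor>))" for x by (auto simp: A_def)
    then show ?thesis by blast
  qed
  finally have "infsum c UNIV = (\<integral>x. u x \<partial>lborel)" by (simp add: set_lebesgue_integral_def)
  moreover have "(c has_sum integral {0..1} (\<lambda>x. \<Sum>\<^sub>\<infinity>k. u (x + of_int k))) UNIV"
    unfolding c_def by (rule has_sum_integral[OF cont' bound M])
  ultimately show ?thesis by (metis infsumI)
qed

lemma summable_on_compose_bounded_fibres:
  fixes a :: "'b \<Rightarrow> real" and \<phi> :: "'a \<Rightarrow> 'b"
  assumes a: "\<And>m. 0 \<le> a m" and sum: "a summable_on UNIV"
    and fibres: "\<And>m. finite {k. \<phi> k = m}" "\<And>m. card {k. \<phi> k = m} \<le> N"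
  shows "(\<lambda>k. a (\<phi> k)) summable_on UNIV"
proof (rule nonneg_bdd_above_summable_on[OF a], rule bdd_aboveI)
  fix y assume "y \<in> sum (\<lambda>k. a (\<phi> k)) ` {F. F \<subseteq> UNIV \<and> finite F}"
  then obtain F where F: "finite F" and y: "y = (\<Sum>k\<in>F. a (\<phi> k))" by auto
  have "y = (\<Sum>m\<in>\<phi> ` F. \<Sum>k\<in>{k \<in> F. \<phi> k = m}. a (\<phi> k))"
    unfolding y using F by (rule sum.image_gen)
  also have "\<dots> = (\<Sum>m\<in>\<phi> ` F. real (card {k \<in> F. \<phi> k = m}) * a m)"
    by (intro sum.cong) auto
  also have "\<dots> \<le> (\<Sum>m\<in>\<phi> ` F. real N * a m)"
  proof (intro sum_mono mult_right_mono a)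
    fix m
    have "card {k \<in> F. \<phi> k = m} \<le> card {k. \<phi> k = m}"
      using fibres(1) by (intro card_mono) auto
    then show "real (card {k \<in> F. \<phi> k = m}) \<le> real N"
      using fibres(2)[of m] by linarith
  qed
  also have "\<dots> = real N * (\<Sum>m\<in>\<phi> ` F. a m)" by (simp add: sum_distrib_left)
  also have "\<dots> \<le> real N * infsum a UNIV"
    using F a by (intro mult_left_mono finite_sum_le_infsum sum) auto
  finally show "y \<le> real N * infsum a UNIV" .
qed

text \<open>
  Two integers with the same value of \<open>\<lfloor>\<alpha> k\<rfloor>\<close> differ by less than \<open>1 / \<alpha>\<close>, which bounds the size of the
  fibres.
\<close>

lemma summable_on_floor_scaled:
  fixes a :: "int \<Rightarrow> real" and \<alpha> :: real
  assumes a: "\<And>m. 0 \<le> a m" and sum: "a summable_on UNIV" and lam: "0 < \<alpha>"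
  shows "(\<lambda>k::int. a (\<lfloor>\<alpha> * of_int k\<rfloor> + j)) summable_on UNIV"
proof (rule summable_on_compose_bounded_fibres[OF a sum])
  define M where "M = \<lceil>1 / \<alpha>\<rceil>"
  fix m
  have "\<exists>l. {k::int. \<lfloor>\<alpha> * of_int k\<rfloor> + j = m} \<subseteq> {l - M..l + M}"
  proof (cases "{k::int. \<lfloor>\<alpha> * of_int k\<rfloor> + j = m} = {}")
    case False
    then obtain l :: int where l: "\<lfloor>\<alpha> * of_int l\<rfloor> + j = m" by auto
    have "k \<in> {l - M..l + M}" if k: "\<lfloor>\<alpha> * of_int k\<rfloor> + j = m" for k :: int
    proof -
      have "\<bar>\<alpha> * of_int k - \<alpha> * of_int l\<bar> < 1" using k l by linarith
      moreover have "\<alpha> * of_int k - \<alpha> * of_int l = \<alpha> * of_int (k - l)" by (simp add: algebra_simps)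
      ultimately have "\<alpha> * \<bar>of_int (k - l)\<bar> < 1" using lam by (simp add: abs_mult)
      then have "\<bar>of_int (k - l)\<bar> < 1 / \<alpha>" using lam by (simp add: field_simps)
      also have "1 / \<alpha> \<le> of_int M" unfolding M_def by (rule le_of_int_ceiling)
      finally have "\<bar>k - l\<bar> < M" by linarith
      then show ?thesis by auto
    qed
    then show ?thesis by blast
  qed blast
  then obtain l where l: "{k::int. \<lfloor>\<alpha> * of_int k\<rfloor> + j = m} \<subseteq> {l - M..l + M}" by blast
  then show "finite {k::int. \<lfloor>\<alpha> * of_int k\<rfloor> + j = m}" by (rule finite_subset) simp
  show "card {k::int. \<lfloor>\<alpha> * of_int k\<rfloor> + j = m} \<le> nat (2 * M + 1)"
    using card_mono[OF _ l] by (simp add: algebra_simps)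
qed

text \<open>
  For \<open>x\<close> in the unit interval, \<open>\<alpha> (x + k)\<close> lies in one of boundedly many unit intervals, the first of
  which is the one that contains \<open>\<alpha> k\<close>. The sum of the local suprema over all of them is a majorant that
  does not depend on \<open>x\<close>, as the Weierstrass test requires.
\<close>

lemma wiener_scaled_majorant:
  assumes cont: "continuous_on UNIV f" and W: "f \<in> wiener_space" and lam: "0 < \<alpha>"
  obtains M where "M summable_on UNIV"
    "\<And>k x. x \<in> {0..1} \<Longrightarrow> cmod (f (\<alpha> * (x + of_int k))) \<le> M k"
proof
  define a where "a k = enn2real (local_esssup f k)" for k
  have a: "0 \<le> a k" for k by (simp add: a_def)
  have fa: "cmod (f y) \<le> a \<lfloor>y\<rfloor>" for y
    using cmod_le_local_esssup[OF cont wiener_local_esssup_finite[OF W], of "y - of_int \<lfloor>y\<rfloor>" "\<lfloor>y\<rfloor>"]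
    unfolding a_def by (simp; linarith)
  define J where "J = {0..\<lceil>\<alpha>\<rceil>}"
  define M where "M k = (\<Sum>j\<in>J. a (\<lfloor>\<alpha> * of_int k\<rfloor> + j))" for k :: int
  have "(\<lambda>k. \<Sum>j\<in>I. a (\<lfloor>\<alpha> * of_int k\<rfloor> + j)) summable_on UNIV" if "finite I" for I
    using that summable_on_floor_scaled[OF a wiener_local_esssup_summable[OF W, folded a_def] lam]
    by (induction I rule: finite_induct) (auto intro: summable_on_add)
  then show "M summable_on UNIV" unfolding M_def by (simp add: J_def)
  fix k :: int and x :: real assume x: "x \<in> {0..1}"
  define j where "j = \<lfloor>\<alpha> * (x + of_int k)\<rfloor> - \<lfloor>\<alpha> * of_int k\<rfloor>"
  have "0 \<le> \<alpha> * x" "\<alpha> * x \<le> \<alpha>" using x lam by (auto simp: mult_left_le)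
  then have "j \<in> J" unfolding j_def J_def by (simp add: distrib_left; linarith)
  then have "a (\<lfloor>\<alpha> * of_int k\<rfloor> + j) \<le> M k"
    unfolding M_def by (intro member_le_sum a) (auto simp: J_def)
  then show "cmod (f (\<alpha> * (x + of_int k))) \<le> M k"
    using fa[of "\<alpha> * (x + of_int k)"] by (simp add: j_def)
qed

lemma cis_periodic_int: "cis (2 * pi * of_int n * (x + of_int k)) = cis (2 * pi * of_int n * x)"
proof -
  have "cis (2 * pi * of_int (n * k)) = 1" by (rule cis_multiple_2pi) simp
  moreover have "2 * pi * of_int n * (x + of_int k) = 2 * pi * of_int n * x + 2 * pi * of_int (n * k)"
    by (simp add: algebra_simps)
  ultimately show ?thesis by (simp flip: cis_mult)
qed

text \<open>
  Both sides are continuous and periodic in \<open>x\<close> with period 1, so it is enough to compare their Fourier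
  coefficients. Those of the periodization \<open>P\<close> are values of \<open>fourier f\<close> by
  \<open>integral_periodization\<close> and the substitution \<open>x \<mapsto> \<alpha> x\<close>; those of the absolutely convergent trigonometric series \<open>Q\<close> can be read off. The
  factor \<open>cis (- 2 \<pi> \<gamma> (x + k))\<close>, rather than \<open>cis (- 2 \<pi> \<gamma> k)\<close>, makes the left-hand side exactly
  periodic.
\<close>

lemma poisson_summation:
  assumes cont: "continuous_on UNIV f" and W: "f \<in> wiener_space" and lam: "0 < \<alpha>"
    and summ: "(\<lambda>n::int. cmod (fourier f ((\<gamma> + of_int n) / \<alpha>))) summable_on UNIV"
  shows "(\<Sum>\<^sub>\<infinity>k::int. f (\<alpha> * (x + of_int k)) * cis (- (2 * pi * \<gamma> * (x + of_int k)))) =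
         (\<Sum>\<^sub>\<infinity>n::int. fourier f ((\<gamma> + of_int n) / \<alpha>) * cis (2 * pi * of_int n * x)) / \<alpha>"
proof -
  obtain M where M: "M summable_on UNIV"
    "\<And>k x. x \<in> {0..1} \<Longrightarrow> cmod (f (\<alpha> * (x + of_int k))) \<le> M k"
    using wiener_scaled_majorant[OF cont W lam] by blast
  define u where "u x = f (\<alpha> * x) * cis (- (2 * pi * \<gamma> * x))" for x
  define q where "q n = fourier f ((\<gamma> + of_int n) / \<alpha>) / \<alpha>" for n :: int
  define P where "P x = (\<Sum>\<^sub>\<infinity>k::int. u (x + of_int k))" for x
  define Q where "Q x = (\<Sum>\<^sub>\<infinity>n::int. q n * cis (2 * pi * of_int n * x))" for x
  have cu: "continuous_on A u" for A
    unfolding u_def by (intro continuous_intros continuous_on_compose2[OF cont]) auto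
  have bu: "cmod (u (x + of_int k)) \<le> M k" if "x \<in> {0..1}" for x k
    using M(2)[OF that] by (simp add: u_def norm_mult)
  have q: "(\<lambda>n. cmod (q n)) summable_on UNIV"
    using summable_on_cmult_left[OF summ, of "inverse \<alpha>"] lam
    by (simp add: q_def norm_mult norm_inverse divide_inverse)
  have cP: "continuous_on {0..1} P" unfolding P_def
    by (rule continuous_on_infsum[OF _ bu M(1)]) (auto intro!: continuous_on_compose2[OF cu] continuous_intros)
  have cQ: "continuous_on {0..1} Q" unfolding Q_def
    by (rule continuous_on_infsum[OF _ _ q]) (auto intro!: continuous_intros simp: norm_mult)
  have momP: "integral {0..1} (\<lambda>x. P x * cis (2 * pi * of_int n * x)) = q (- n)" for n
  proof -
    define v where "v x = u x * cis (2 * pi * of_int n * x)" for x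
    have "P x * cis (2 * pi * of_int n * x) = (\<Sum>\<^sub>\<infinity>k::int. v (x + of_int k))" for x
      unfolding P_def v_def cis_periodic_int by (rule infsum_cmult_left'[symmetric])
    then have "integral {0..1} (\<lambda>x. P x * cis (2 * pi * of_int n * x)) = (\<integral>x. v x \<partial>lborel)"
      using integral_periodization[OF _ _ M(1), of v] bu
      by (simp add: v_def norm_mult continuous_on_mult[OF cu] continuous_intros)
    also have "\<dots> = (\<integral>x. f (\<alpha> * x) * cis (- (2 * pi * (\<gamma> - of_int n) * x)) \<partial>lborel)"
      unfolding v_def u_def by (simp add: mult.assoc cis_mult algebra_simps)
    also have "\<dots> = q (- n)"
      unfolding q_def fourier_cis using lam
      by (subst (2) lborel_integral_real_affine[where c=\<alpha> and t=0])
         (simp_all add: scaleR_conv_of_real mult_ac)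
    finally show ?thesis .
  qed
  have momQ: "integral {0..1} (\<lambda>x. Q x * cis (2 * pi * of_int n * x)) = q (- n)" for n
  proof -
    have eq: "Q x * cis (2 * pi * of_int n * x) = (\<Sum>\<^sub>\<infinity>m. q m * cis (2 * pi * of_int (m + n) * x))" for x
      unfolding Q_def infsum_cmult_left'[symmetric]
      by (intro infsum_cong) (simp add: mult.assoc cis_mult algebra_simps)
    have i: "integral {0..1} (\<lambda>x. q m * cis (2 * pi * of_int (m + n) * x)) = (if m = - n then q (- n) else 0)" for m
      by (simp only: integral_mult_right integral_cis_01) (auto simp: add_eq_0_iff2)
    have "((\<lambda>m. if m = - n then q (- n) else 0) has_sum
          integral {0..1} (\<lambda>x. Q x * cis (2 * pi * of_int n * x))) UNIV"
      unfolding eq i[symmetric]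
      by (rule has_sum_integral[OF _ _ q]) (auto intro!: continuous_intros simp: norm_mult)
    moreover have "((\<lambda>m. if m = - n then q (- n) else 0) has_sum q (- n)) UNIV"
      by (rule has_sum_finite_neutralI[of "{- n}"]) auto
    ultimately show ?thesis by (rule has_sum_unique)
  qed
  have PQ01: "P x = Q x" if "x \<in> {0..1}" for x
  proof -
    have "P x - Q x = 0"
    proof (rule zero_if_fourier_coefficients_zero[of "\<lambda>x. P x - Q x"])
      fix n :: int
      have "integral {0..1} (\<lambda>x. (P x - Q x) * cis (2 * pi * of_int n * x)) =
        integral {0..1} (\<lambda>x. P x * cis (2 * pi * of_int n * x)) - integral {0..1} (\<lambda>x. Q x * cis (2 * pi * of_int n * x))"
        unfolding left_diff_distrib
        by (intro integral_diff integrable_continuous_interval continuous_intros cP cQ)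
      then show "integral {0..1} (\<lambda>x. (P x - Q x) * cis (2 * pi * of_int n * x)) = 0"
        by (simp add: momP momQ)
    qed (use that in \<open>auto intro: continuous_intros cP cQ\<close>)
    then show ?thesis by simp
  qed
  have perP: "P (x + of_int m) = P x" for x m
    unfolding P_def using infsum_reindex_bij_betw[of "\<lambda>k. k + m" UNIV UNIV "\<lambda>k. u (x + of_int k)"]
    by (simp add: bij_plus_right algebra_simps)
  have perQ: "Q (x + of_int m) = Q x" for x m
    unfolding Q_def cis_periodic_int ..
  have "P x = P (frac x)" "Q x = Q (frac x)"
    using perP[of "frac x" "\<lfloor>x\<rfloor>"] perQ[of "frac x" "\<lfloor>x\<rfloor>"] by (simp_all add: frac_def)
  moreover have "P (frac x) = Q (frac x)"
    by (rule PQ01) (auto simp: frac_ge_0 frac_lt_1 less_imp_le)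
  ultimately have "P x = Q x" by simp
  moreover have "Q x = (\<Sum>\<^sub>\<infinity>n::int. fourier f ((\<gamma> + of_int n) / \<alpha>) * cis (2 * pi * of_int n * x)) / \<alpha>"
    unfolding Q_def q_def by (simp add: divide_inverse mult_ac infsum_cmult_right')
  ultimately show ?thesis by (simp add: P_def u_def)
qed

section \<open>The Zak transform of an eigenfunction\<close>

lemma zak_cis:
  "zak \<alpha> f x \<gamma> = of_real (sqrt \<alpha>) *
     (\<Sum>\<^sub>\<infinity>k::int. f (\<alpha> * (x + of_int k)) * cis (- (2 * pi * of_int k * \<gamma>)))"
  unfolding zak_def by (simp add: cis_conv_exp mult_ac)

lemma zak_summable:
  assumes "continuous_on UNIV f" "f \<in> wiener_space" "0 < \<alpha>"
  shows "(\<lambda>k::int. cmod (f (\<alpha> * (x + of_int k)))) summable_on UNIV"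
proof -
  have "cmod (f (\<alpha> * (x + of_int k)) * exp (- 2 * of_real pi * \<i> * of_int k * of_real 0)) =
      cmod (f (\<alpha> * (x + of_int k)))" for k :: int by simp
  then show ?thesis using zak_abs_summable[OF assms, of x 0] by simp
qed

lemma zak_shift:
  "zak \<alpha> f (x + of_int q) (\<gamma> + of_int n) = cis (2 * pi * of_int q * \<gamma>) * zak \<alpha> f x \<gamma>"
proof -
  define F where "F k = f (\<alpha> * (x + of_int k)) * cis (- (2 * pi * of_int k * \<gamma>))" for k :: int
  have "f (\<alpha> * (x + of_int q + of_int k)) * cis (- (2 * pi * of_int k * (\<gamma> + of_int n))) =
        cis (2 * pi * of_int q * \<gamma>) * F (k + q)" for k
  proof -
    have "cis (- (2 * pi * of_int k * (\<gamma> + of_int n))) = cis (2 * pi * of_int (- k) * (\<gamma> + of_int n))"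
      by simp
    also have "\<dots> = cis (2 * pi * of_int (- k) * \<gamma>)" by (rule cis_periodic_int)
    also have "\<dots> = cis (2 * pi * of_int q * \<gamma>) * cis (- (2 * pi * of_int (k + q) * \<gamma>))"
      by (simp add: cis_mult algebra_simps)
    finally show ?thesis by (simp add: F_def algebra_simps)
  qed
  then have "zak \<alpha> f (x + of_int q) (\<gamma> + of_int n) =
      of_real (sqrt \<alpha>) * (cis (2 * pi * of_int q * \<gamma>) * (\<Sum>\<^sub>\<infinity>k. F (k + q)))"
    unfolding zak_cis by (simp add: infsum_cmult_right')
  also have "(\<Sum>\<^sub>\<infinity>k. F (k + q)) = (\<Sum>\<^sub>\<infinity>k. F k)"
    by (rule infsum_reindex_bij_betw) (rule bij_plus_right)
  finally show ?thesis unfolding zak_cis F_def by (simp add: mult_ac)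
qed

text \<open>
  Poisson summation says that the Fourier transform acts on the Zak transform by the rotation
  \<open>(x, \<gamma>) \<mapsto> (\<gamma>, - x)\<close>, up to a phase.
\<close>

lemma zak_fourier_eigenfunction:
  assumes cont: "continuous_on UNIV f" and W: "f \<in> wiener_space" and lam: "0 < \<alpha>"
    and eig: "fourier f = (\<lambda>t. c * f t)"
  shows "zak \<alpha> f x \<gamma> = c * cis (2 * pi * x * \<gamma>) * zak (1 / \<alpha>) f \<gamma> (- x)"
proof -
  have s: "(\<lambda>n::int. cmod (fourier f ((\<gamma> + of_int n) / \<alpha>))) summable_on UNIV"
    using summable_on_cmult_right[OF zak_summable[OF cont W, of "1 / \<alpha>" \<gamma>], of "cmod c"] lam
    by (simp add: eig norm_mult)
  define T where "T = (\<Sum>\<^sub>\<infinity>n::int. f ((\<gamma> + of_int n) / \<alpha>) * cis (2 * pi * of_int n * x))"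
  have "cis (- (2 * pi * of_int k * \<gamma>)) = cis (2 * pi * x * \<gamma>) * cis (- (2 * pi * \<gamma> * (x + of_int k)))"
    for k :: int by (simp add: cis_mult algebra_simps)
  then have "zak \<alpha> f x \<gamma> = of_real (sqrt \<alpha>) * (\<Sum>\<^sub>\<infinity>k::int. cis (2 * pi * x * \<gamma>) *
      (f (\<alpha> * (x + of_int k)) * cis (- (2 * pi * \<gamma> * (x + of_int k)))))"
    unfolding zak_cis by (simp add: mult_ac)
  also have "\<dots> = of_real (sqrt \<alpha>) * cis (2 * pi * x * \<gamma>) *
      ((\<Sum>\<^sub>\<infinity>n::int. fourier f ((\<gamma> + of_int n) / \<alpha>) * cis (2 * pi * of_int n * x)) / \<alpha>)"
    unfolding infsum_cmult_right' poisson_summation[OF cont W lam s] by (rule mult.assoc[symmetric])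
  also have "\<dots> = c * cis (2 * pi * x * \<gamma>) * (of_real (sqrt \<alpha> / \<alpha>) * T)"
    unfolding eig T_def mult.assoc by (simp add: infsum_cmult_right' mult_ac)
  also have "sqrt \<alpha> / \<alpha> = sqrt (1 / \<alpha>)"
    using lam by (simp add: real_sqrt_divide field_simps)
  also have "of_real (sqrt (1 / \<alpha>)) * T = zak (1 / \<alpha>) f \<gamma> (- x)"
    unfolding zak_cis T_def by simp
  finally show ?thesis .
qed

text \<open>
  Applying the rotation twice gives the point reflection, and the two phases cancel. In this form
  the parity of an eigenfunction is obtained without the Fourier inversion theorem.
\<close>

lemma zak_eigenfunction_reflect:
  assumes cont: "continuous_on UNIV f" and W: "f \<in> wiener_space" and lam: "0 < \<alpha>"
    and eig: "fourier f = (\<lambda>t. c * f t)"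
  shows "zak \<alpha> f x \<gamma> = c\<^sup>2 * zak \<alpha> f (- x) (- \<gamma>)"
proof -
  have "zak \<alpha> f x \<gamma> = c * cis (2 * pi * x * \<gamma>) * zak (1 / \<alpha>) f \<gamma> (- x)"
    by (rule zak_fourier_eigenfunction[OF cont W lam eig])
  also have "zak (1 / \<alpha>) f \<gamma> (- x) = c * cis (2 * pi * \<gamma> * (- x)) * zak (1 / (1 / \<alpha>)) f (- x) (- \<gamma>)"
    using lam by (intro zak_fourier_eigenfunction[OF cont W _ eig]) simp
  also have "c * cis (2 * pi * x * \<gamma>) * \<dots> =
      c\<^sup>2 * (cis (2 * pi * x * \<gamma>) * cis (2 * pi * \<gamma> * (- x))) * zak \<alpha> f (- x) (- \<gamma>)"
    by (simp add: power2_eq_square mult_ac)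
  also have "cis (2 * pi * x * \<gamma>) * cis (2 * pi * \<gamma> * (- x)) = 1"
    by (simp add: cis_mult mult_ac)
  finally show ?thesis by simp
qed

lemma infsum_residue_classes:
  fixes F :: "int \<Rightarrow> complex"
  assumes s: "0 < s" and F: "F summable_on UNIV"
  shows "(\<Sum>\<^sub>\<infinity>k. F k) = (\<Sum>r<s. \<Sum>\<^sub>\<infinity>l. F (int s * l + int r))"
proof -
  have bij: "bij_betw (\<lambda>(r, l). int s * l + int r) ({..<s} \<times> UNIV) UNIV"
    by (rule bij_betw_byWitness[where f' = "\<lambda>k. (nat (k mod int s), k div int s)"])
       (use s in \<open>auto simp: nat_less_iff\<close>)
  have eq: "(\<lambda>p. F ((\<lambda>(r, l). int s * l + int r) p)) = (\<lambda>(r, l). F (int s * l + int r))"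
    by auto
  have "(\<lambda>(r, l). F (int s * l + int r)) summable_on ({..<s} \<times> UNIV)"
    using F unfolding summable_on_reindex_bij_betw[OF bij, of F, symmetric] eq .
  then have "(\<Sum>\<^sub>\<infinity>r\<in>{..<s}. \<Sum>\<^sub>\<infinity>l. F (int s * l + int r)) =
      (\<Sum>\<^sub>\<infinity>(r, l)\<in>{..<s} \<times> UNIV. F (int s * l + int r))"
    by (rule infsum_Sigma'_banach)
  also have "\<dots> = (\<Sum>\<^sub>\<infinity>k. F k)"
    using infsum_reindex_bij_betw[OF bij, of F] unfolding eq .
  finally show ?thesis by simp
qed

text \<open>
  If \<open>\<alpha>\<^sup>2\<close> is an integer \<open>s\<close>, the lattice with spacing \<open>1 / \<alpha> = \<alpha> / s\<close> is the union of \<open>s\<close> translates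
  of the lattice with spacing \<open>\<alpha>\<close>.
\<close>

lemma zak_residue_classes:
  assumes cont: "continuous_on UNIV f" and W: "f \<in> wiener_space" and lam: "0 < \<alpha>"
    and s: "\<alpha>\<^sup>2 = of_nat s"
  shows "zak (1 / \<alpha>) f \<gamma> (- x) =
    (\<Sum>r<s. cis (2 * pi * of_nat r * x) * zak \<alpha> f ((\<gamma> + of_nat r) / of_nat s) (- (of_nat s * x))) / of_real \<alpha>"
proof -
  define F where "F k = f ((1 / \<alpha>) * (\<gamma> + of_int k)) * cis (2 * pi * of_int k * x)" for k :: int
  have s0: "0 < s" using lam s by (metis of_nat_0_less_iff zero_less_power)
  have "(\<lambda>k. cmod (F k)) summable_on UNIV"
    using zak_summable[OF cont W, of "1 / \<alpha>" \<gamma>] lam by (simp add: F_def norm_mult)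
  then have F: "F summable_on UNIV" by (rule abs_summable_summable)
  have arg: "(1 / \<alpha>) * (\<gamma> + of_int (int s * l + int r)) = \<alpha> * ((\<gamma> + of_nat r) / of_nat s + of_int l)"
    for l r using lam by (simp add: field_simps power2_eq_square flip: s)
  have Fres: "F (int s * l + int r) = cis (2 * pi * of_nat r * x) *
      (f (\<alpha> * ((\<gamma> + of_nat r) / of_nat s + of_int l)) * cis (- (2 * pi * of_int l * (- (of_nat s * x)))))" for l r
    unfolding F_def arg by (simp add: cis_mult algebra_simps)
  have "zak (1 / \<alpha>) f \<gamma> (- x) = of_real (sqrt (1 / \<alpha>)) * (\<Sum>\<^sub>\<infinity>k. F k)"
    unfolding zak_cis F_def by simp
  also have "sqrt (1 / \<alpha>) = sqrt \<alpha> / \<alpha>"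
    using lam by (simp add: real_sqrt_divide field_simps)
  also have "(\<Sum>\<^sub>\<infinity>k. F k) = (\<Sum>r<s. \<Sum>\<^sub>\<infinity>l. F (int s * l + int r))"
    by (rule infsum_residue_classes[OF s0 F])
  finally show ?thesis
    unfolding zak_cis Fres infsum_cmult_right'
    by (simp add: sum_distrib_left mult_ac sum_divide_distrib)
qed

text \<open>
  This relates values of one and the same function \<open>zak \<alpha> f\<close>. At suitable rational
  points, each point on the right is, up to the symmetries, either the point on the left again or a
  known zero, and the relation becomes a linear equation for a single value.
\<close>

lemma zak_sqrt_eigenfunction:
  assumes cont: "continuous_on UNIV f" and W: "f \<in> wiener_space" and lam: "0 < \<alpha>"
    and eig: "fourier f = (\<lambda>t. c * f t)" and s: "\<alpha>\<^sup>2 = of_nat s"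
  shows "zak \<alpha> f x \<gamma> = c * cis (2 * pi * x * \<gamma>) *
    (\<Sum>r<s. cis (2 * pi * of_nat r * x) * zak \<alpha> f ((\<gamma> + of_nat r) / of_nat s) (- (of_nat s * x))) / of_real \<alpha>"
  unfolding zak_fourier_eigenfunction[OF cont W lam eig, of x \<gamma>] zak_residue_classes[OF cont W lam s] 
  by simp

section \<open>Zeros of the Zak transform\<close>

lemma zak_eq_0_shift_iff:
  "zak \<alpha> f (x + of_int q) (\<gamma> + of_int n) = 0 \<longleftrightarrow> zak \<alpha> f x \<gamma> = 0"
  unfolding zak_shift by (simp del: of_int_mult)

text \<open>
  The point \<open>(1 / 2, 1 / 2)\<close> is fixed by the reflection up to an integer translation, for which the
  quasi-periodicity factor is \<open>- 1\<close>.
\<close>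

lemma zak_even_half_half:
  assumes "\<And>x \<gamma>. zak \<alpha> f x \<gamma> = zak \<alpha> f (- x) (- \<gamma>)"
  shows "zak \<alpha> f (1 / 2) (1 / 2) = 0"
proof -
  have "zak \<alpha> f (1 / 2) (1 / 2) = zak \<alpha> f (- (1 / 2)) (- (1 / 2))" by (rule assms)
  also have "\<dots> = - zak \<alpha> f (- (1 / 2) + of_int 1) (- (1 / 2) + of_int 1)"
    unfolding zak_shift by (simp add: complex_eq_iff)
  finally show ?thesis by simp
qed

text \<open>
  At \<open>(1 / 4, 1 / 2)\<close> the relation refers to the points with \<open>x = 1 / 4\<close> and \<open>x = 3 / 4\<close>, where the values of \<open>Z\<close>
  are opposite; with these signs the phases add up to \<open>sqrt 2\<close>, so that \<open>Z = - Z\<close>.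
\<close>

lemma zak_sqrt2_even_zeros:
  assumes cont: "continuous_on UNIV f" and W: "f \<in> wiener_space" and eig: "fourier f = (\<lambda>t. - 1 * f t)"
  defines "Z \<equiv> zak (sqrt 2) f"
  shows "Z (1 / 4) (1 / 2) = 0" "Z (1 / 2) (1 / 2) = 0" "Z (3 / 4) (1 / 2) = 0"
proof -
  have even: "Z x \<gamma> = Z (- x) (- \<gamma>)" for x \<gamma>
    using zak_eigenfunction_reflect[OF cont W _ eig, of "sqrt 2" x \<gamma>] by (simp add: Z_def)
  show "Z (1 / 2) (1 / 2) = 0"
    using even unfolding Z_def by (rule zak_even_half_half)
  have Z1: "Z (1 / 4) (- (1 / 2)) = Z (1 / 4) (1 / 2)"
    using zak_shift[of "sqrt 2" f "1 / 4" 0 "- (1 / 2)" 1] by (simp add: Z_def)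
  have Z3: "Z (3 / 4) (1 / 2) = - Z (1 / 4) (1 / 2)"
  proof -
    have "Z (3 / 4) (1 / 2) = - Z (- (1 / 4)) (1 / 2)"
      using zak_shift[of "sqrt 2" f "- (1 / 4)" 1 "1 / 2" 0] by (simp add: Z_def)
    then show ?thesis using even[of "- (1 / 4)" "1 / 2"] Z1 by simp
  qed
  have Z3': "Z (3 / 4) (- (1 / 2)) = Z (3 / 4) (1 / 2)"
    using zak_shift[of "sqrt 2" f "3 / 4" 0 "- (1 / 2)" 1] by (simp add: Z_def)
  have phase: "cis (pi / 4) * (1 - cis (pi / 2)) = of_real (sqrt 2)"
    by (simp add: complex_eq_iff cos_45 sin_45)
  have "Z (1 / 4) (1 / 2) = - (cis (pi / 4) *
      (Z (1 / 4) (- (1 / 2)) + cis (pi / 2) * Z (3 / 4) (- (1 / 2)))) / of_real (sqrt 2)"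
    using zak_sqrt_eigenfunction[OF cont W _ eig, of "sqrt 2" 2 "1 / 4" "1 / 2"]
    by (simp add: Z_def numeral_2_eq_2 lessThan_Suc)
  also have "\<dots> = - (cis (pi / 4) * (1 - cis (pi / 2))) / of_real (sqrt 2) * Z (1 / 4) (1 / 2)"
    unfolding Z1 Z3' Z3 by (simp add: algebra_simps)
  also have "\<dots> = - Z (1 / 4) (1 / 2)" unfolding phase by simp
  finally show Z0: "Z (1 / 4) (1 / 2) = 0" by simp
  show "Z (3 / 4) (1 / 2) = 0" unfolding Z3 Z0 by simp
qed

text \<open>
  At \<open>(1 / 6, 1 / 2)\<close> the relation refers to \<open>x = 1 / 6, 1 / 2, 5 / 6\<close>. The middle value vanishes and the outer
  ones are opposite; with these signs the phases add up to \<open>sqrt 3\<close>, so that \<open>Z = - Z\<close>.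
\<close>

lemma zak_sqrt3_even_zeros:
  assumes cont: "continuous_on UNIV f" and W: "f \<in> wiener_space" and eig: "fourier f = (\<lambda>t. - 1 * f t)"
  defines "Z \<equiv> zak (sqrt 3) f"
  shows "Z (1 / 6) (1 / 2) = 0" "Z (1 / 2) (1 / 2) = 0" "Z (5 / 6) (1 / 2) = 0"
proof -
  have even: "Z x \<gamma> = Z (- x) (- \<gamma>)" for x \<gamma>
    using zak_eigenfunction_reflect[OF cont W _ eig, of "sqrt 3" x \<gamma>] by (simp add: Z_def)
  show half: "Z (1 / 2) (1 / 2) = 0"
    using even unfolding Z_def by (rule zak_even_half_half)
  have neg: "Z x (- (1 / 2)) = Z x (1 / 2)" for x
    using zak_shift[of "sqrt 3" f x 0 "- (1 / 2)" 1] by (simp add: Z_def)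
  have Z5: "Z (5 / 6) (1 / 2) = - Z (1 / 6) (1 / 2)"
  proof -
    have "Z (5 / 6) (1 / 2) = - Z (- (1 / 6)) (1 / 2)"
      using zak_shift[of "sqrt 3" f "- (1 / 6)" 1 "1 / 2" 0] by (simp add: Z_def)
    then show ?thesis using even[of "- (1 / 6)" "1 / 2"] neg by simp
  qed
  have phase: "cis (pi / 6) * (1 - cis (2 * pi / 3)) = of_real (sqrt 3)"
    by (simp add: complex_eq_iff cos_30 sin_30 cos_120 sin_120)
  have "Z (1 / 6) (1 / 2) = - (cis (pi / 6) * (Z (1 / 6) (- (1 / 2)) + cis (pi / 3) * Z (1 / 2) (- (1 / 2))
      + cis (2 * pi / 3) * Z (5 / 6) (- (1 / 2)))) / of_real (sqrt 3)"
    using zak_sqrt_eigenfunction[OF cont W _ eig, of "sqrt 3" 3 "1 / 6" "1 / 2"]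
    by (simp add: Z_def numeral_3_eq_3 lessThan_Suc algebra_simps)
  also have "\<dots> = - (cis (pi / 6) * (1 - cis (2 * pi / 3))) / of_real (sqrt 3) * Z (1 / 6) (1 / 2)"
    unfolding neg Z5 half by (simp add: algebra_simps)
  also have "\<dots> = - Z (1 / 6) (1 / 2)" unfolding phase by simp
  finally show Z0: "Z (1 / 6) (1 / 2) = 0" by simp
  show "Z (5 / 6) (1 / 2) = 0" unfolding Z5 Z0 by simp
qed

text \<open>
  On the line \<open>\<gamma> = 0\<close>, oddness and periodicity make \<open>x\<close> and \<open>1 - x\<close> have opposite values, so that
  \<open>0\<close> and \<open>1 / 2\<close> are zeros for every \<open>\<alpha>\<close>. At \<open>1 / 3\<close> for \<open>\<alpha> = sqrt 3\<close>, and at \<open>1 / 4\<close>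
  for \<open>\<alpha> = 2\<close>, the relation is left with two opposite values, whose phases differ by \<open>\<i> * \<alpha>\<close>.
\<close>

lemma zak_odd_zeros:
  assumes cont: "continuous_on UNIV f" and W: "f \<in> wiener_space" and eig: "fourier f = (\<lambda>t. \<i> * f t)"
  shows "0 < \<alpha> \<Longrightarrow> zak \<alpha> f 0 0 = 0" "0 < \<alpha> \<Longrightarrow> zak \<alpha> f (1 / 2) 0 = 0"
    and "zak (sqrt 3) f (1 / 3) 0 = 0" "zak (sqrt 3) f (2 / 3) 0 = 0"
    and "zak 2 f (1 / 4) 0 = 0" "zak 2 f (3 / 4) 0 = 0"
proof -
  have odd: "zak \<alpha> f x \<gamma> = - zak \<alpha> f (- x) (- \<gamma>)" if "0 < \<alpha>" for \<alpha> x \<gamma>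
    using zak_eigenfunction_reflect[OF cont W that eig, of x \<gamma>] by simp
  have refl: "zak \<alpha> f (1 - x) 0 = - zak \<alpha> f x 0" if "0 < \<alpha>" for \<alpha> x
    using odd[OF that, of x 0] zak_shift[of \<alpha> f "- x" 1 0 0] by simp
  have per: "zak \<alpha> f x (- 1) = zak \<alpha> f x 0" for \<alpha> x
    using zak_shift[of \<alpha> f x 0 0 "- 1"] by simp
  show zero: "zak \<alpha> f 0 0 = 0" if "0 < \<alpha>" for \<alpha> using odd[OF that, of 0 0] by simp
  show half: "zak \<alpha> f (1 / 2) 0 = 0" if "0 < \<alpha>" for \<alpha> using refl[OF that, of "1 / 2"] by simp
  show third: "zak (sqrt 3) f (1 / 3) 0 = 0"
  proof -
    define Z where "Z = zak (sqrt 3) f"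
    have Z0: "Z 0 0 = 0" unfolding Z_def by (rule zero) simp
    have Z2: "Z (2 / 3) 0 = - Z (1 / 3) 0" unfolding Z_def using refl[of "sqrt 3" "1 / 3"] by simp
    have phase: "cis (2 * pi / 3) - cis (4 * pi / 3) = \<i> * of_real (sqrt 3)"
    proof -
      have "cis (4 * pi / 3) = cis (2 * pi / 3) * cis (2 * pi / 3)" by (simp add: cis_mult)
      then show ?thesis by (simp add: complex_eq_iff cos_120 sin_120)
    qed
    have "Z (1 / 3) 0 = \<i> * (Z 0 (- 1) + cis (2 * pi / 3) * Z (1 / 3) (- 1)
        + cis (4 * pi / 3) * Z (2 / 3) (- 1)) / of_real (sqrt 3)"
      using zak_sqrt_eigenfunction[OF cont W _ eig, of "sqrt 3" 3 "1 / 3" 0]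
      by (simp add: Z_def numeral_3_eq_3 lessThan_Suc algebra_simps)
    also have "\<dots> = \<i> * (cis (2 * pi / 3) - cis (4 * pi / 3)) / of_real (sqrt 3) * Z (1 / 3) 0"
      using per[of "sqrt 3", folded Z_def] by (simp add: Z0 Z2 algebra_simps)
    also have "\<dots> = - Z (1 / 3) 0" unfolding phase by simp
    finally show ?thesis by (simp add: Z_def)
  qed
  show quarter: "zak 2 f (1 / 4) 0 = 0"
  proof -
    define Z where "Z = zak 2 f"
    have Z0: "Z 0 0 = 0" "Z (1 / 2) 0 = 0" unfolding Z_def by (simp_all add: zero half)
    have Z3: "Z (3 / 4) 0 = - Z (1 / 4) 0" unfolding Z_def using refl[of 2 "1 / 4"] by simp
    have phase: "cis (pi / 2) = \<i>" "cis (3 * pi / 2) = - \<i>"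
    proof -
      show "cis (pi / 2) = \<i>" by (simp add: complex_eq_iff)
      moreover have "cis (3 * pi / 2) = cis pi * cis (pi / 2)" unfolding cis_mult by (simp add: field_simps)
      ultimately show "cis (3 * pi / 2) = - \<i>" by simp
    qed
    have "Z (1 / 4) 0 = \<i> * (Z 0 (- 1) + cis (pi / 2) * Z (1 / 4) (- 1)
        + cis pi * Z (1 / 2) (- 1) + cis (3 * pi / 2) * Z (3 / 4) (- 1)) / 2"
      using zak_sqrt_eigenfunction[OF cont W _ eig, of 2 4 "1 / 4" 0]
      by (simp add: Z_def eval_nat_numeral lessThan_Suc algebra_simps)
    also have "\<dots> = - Z (1 / 4) 0"
      using per[of 2, folded Z_def] by (simp add: Z0 Z3 phase)
    finally show ?thesis by (simp add: Z_def)
  qed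
  show "zak (sqrt 3) f (2 / 3) 0 = 0" using refl[of "sqrt 3" "1 / 3"] third by simp
  show "zak 2 f (3 / 4) 0 = 0" using refl[of 2 "1 / 4"] quarter by simp
qed

theorem lemma5:
  shows "(\<forall>g \<in> fourier_eigenspace 2 \<inter> wiener_space.
            (\<forall>x \<in> {of_int m / 4 | m :: int. True} - \<int>. \<forall>\<gamma> \<in> {of_int n + 1 / 2 | n :: int. True}.
               zak (sqrt 2) (continuous_rep g) x \<gamma> = 0) \<and>
            (\<forall>x \<in> {of_int m / 3 + 1 / 6 | m :: int. True}. \<forall>\<gamma> \<in> {of_int n + 1 / 2 | n :: int. True}.
               zak (sqrt 3) (continuous_rep g) x \<gamma> = 0)) \<and>
         (\<forall>g \<in> fourier_eigenspace 3 \<inter> wiener_space. \<forall>s \<in> {2, 3, 4 :: nat}.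
            \<forall>x \<in> {of_int m / of_nat s | m :: int. True}. \<forall>\<gamma> \<in> \<int>.
              zak (sqrt (of_nat s)) (continuous_rep g) x \<gamma> = 0)"
proof (intro conjI ballI)
  fix g and x \<gamma> :: real
  assume g: "g \<in> fourier_eigenspace 2 \<inter> wiener_space"
    and x: "x \<in> {of_int m / 4 | m :: int. True} - \<int>" and \<gamma>: "\<gamma> \<in> {of_int n + 1 / 2 | n :: int. True}"
  define h where "h = continuous_rep g"
  have h: "continuous_on UNIV h" "h \<in> wiener_space" "fourier h = (\<lambda>t. - 1 * h t)"
    using continuous_rep_eigenfunction[of g 2] g by (auto simp: h_def power2_eq_square)
  from x \<gamma> obtain m n :: int where m: "x = of_int m / 4" "x \<notin> \<int>" and n: "\<gamma> = 1 / 2 + of_int n" by auto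
  define r where "r = m mod 4"
  have x_eq: "x = of_int r / 4 + of_int (m div 4)"
    using of_int_div_aux[of m 4, where 'a=real] by (simp add: m(1) r_def)
  have "r \<noteq> 0" using m(2) x_eq by auto
  moreover have "0 \<le> r" "r < 4" by (simp_all add: r_def)
  ultimately have "r = 1 \<or> r = 2 \<or> r = 3" by linarith
  then have "zak (sqrt 2) h (of_int r / 4) (1 / 2) = 0"
    using zak_sqrt2_even_zeros[OF h] by auto
  then show "zak (sqrt 2) (continuous_rep g) x \<gamma> = 0"
    unfolding x_eq n h_def zak_eq_0_shift_iff .
next
  fix g and x \<gamma> :: real
  assume g: "g \<in> fourier_eigenspace 2 \<inter> wiener_space"
    and x: "x \<in> {of_int m / 3 + 1 / 6 | m :: int. True}" and \<gamma>: "\<gamma> \<in> {of_int n + 1 / 2 | n :: int. True}"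
  define h where "h = continuous_rep g"
  have h: "continuous_on UNIV h" "h \<in> wiener_space" "fourier h = (\<lambda>t. - 1 * h t)"
    using continuous_rep_eigenfunction[of g 2] g by (auto simp: h_def power2_eq_square)
  from x \<gamma> obtain m n :: int where m: "x = of_int m / 3 + 1 / 6" and n: "\<gamma> = 1 / 2 + of_int n" by auto
  define r where "r = m mod 3"
  have x_eq: "x = (of_int r / 3 + 1 / 6) + of_int (m div 3)"
    using of_int_div_aux[of m 3, where 'a=real] by (simp add: m r_def)
  have "0 \<le> r" "r < 3" by (simp_all add: r_def)
  then have "r = 0 \<or> r = 1 \<or> r = 2" by linarith
  then have "zak (sqrt 3) h (of_int r / 3 + 1 / 6) (1 / 2) = 0"
    using zak_sqrt3_even_zeros[OF h] by auto
  then show "zak (sqrt 3) (continuous_rep g) x \<gamma> = 0"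
    unfolding x_eq n h_def zak_eq_0_shift_iff .
next
  fix g and x \<gamma> :: real and s :: nat
  assume g: "g \<in> fourier_eigenspace 3 \<inter> wiener_space" and s: "s \<in> {2, 3, 4}"
    and x: "x \<in> {of_int m / of_nat s | m :: int. True}" and \<gamma>: "\<gamma> \<in> \<int>"
  define h where "h = continuous_rep g"
  have h: "continuous_on UNIV h" "h \<in> wiener_space" "fourier h = (\<lambda>t. \<i> * h t)"
    using continuous_rep_eigenfunction[of g 3] g by (auto simp: h_def power3_eq_cube)
  from x obtain m :: int where m: "x = of_int m / of_nat s" by auto
  obtain n :: int where n: "\<gamma> = 0 + of_int n" using Ints_cases[OF \<gamma>] by auto
  define r where "r = m mod int s"
  have s0: "0 < s" using s by auto
  have x_eq: "x = of_int r / of_nat s + of_int (m div int s)"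
    using of_int_div_aux[of m "int s", where 'a=real] by (simp add: m r_def)
  have r: "0 \<le> r" "r < int s" using s0 by (simp_all add: r_def)
  have base: "zak (sqrt (of_nat s)) h (of_int r / of_nat s) 0 = 0"
  proof -
    have pos: "0 < sqrt (real s)" using s0 by simp
    note zeros = zak_odd_zeros(1,2)[OF h pos] zak_odd_zeros(3-6)[OF h]
    from s consider "s = 2" | "s = 3" | "s = 4" by auto
    then show ?thesis
    proof cases
      case 1
      then have "r = 0 \<or> r = 1" using r by linarith
      then show ?thesis using zeros(1,2) 1 by auto
    next
      case 2
      then have "r = 0 \<or> r = 1 \<or> r = 2" using r by linarith
      then show ?thesis using zeros(1,3,4) 2 by auto
    next
      case 3
      then have "r = 0 \<or> r = 1 \<or> r = 2 \<or> r = 3" using r by linarith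
      moreover have "sqrt (real s) = 2" using 3 by simp
      ultimately show ?thesis using zeros(1,2,5,6) 3 by auto
    qed
  qed
  then show "zak (sqrt (of_nat s)) (continuous_rep g) x \<gamma> = 0"
    unfolding x_eq n h_def zak_eq_0_shift_iff .
qed

thm_deps lemma5

end
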